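(* Let $\Gamma\subset\mathbb{R}^2$ be any strictly convex closed planar curve of class $C^2$. Then there exists an angle $\rho$ between two lines $\Delta_1,\Delta_2\subset\mathbb{R}^2$ through the origin such that the pair $(\Gamma,\Delta_1\cup\Delta_2)$ is a Heisenberg uniqueness pair for $L^1(\Gamma)$; that is, there exist two lines $\Delta_1,\Delta_2$ through the origin, making some angle $\rho$, such that for every complex-valued $g\in L^1(\Gamma)$, $$\int_\Gamma e^{-i\lambda\cdot x}g(x)\,d\sigma(x)=0\ \text{ for all }\lambda\in\Delta_1\cup\Delta_2\quad\Longrightarrow\quad g=0\ \text{ a.e. on }\Gamma .$$
   Context: $d\sigma$ is the arc length measure on $\Gamma$ and $L^1(\Gamma)=L^1(\Gamma,d\sigma)$. A strictly convex closed planar curve is the boundary of a bounded convex domain in $\mathbb{R}^2$ that contains no nondegenerate line segment. *)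

theory Defs
  imports "HOL-Analysis.Analysis"
begin

definition strictly_convex_closed_curve :: "(real ^ 2) set \<Rightarrow> bool" where
  "strictly_convex_closed_curve \<Gamma> \<longleftrightarrow>
     (\<exists>\<Omega>. open \<Omega> \<and> convex \<Omega> \<and> bounded \<Omega> \<and> \<Omega> \<noteq> {} \<and> \<Gamma> = frontier \<Omega>) \<and>
     (\<forall>a b. closed_segment a b \<subseteq> \<Gamma> \<longrightarrow> a = b)"

(* Period 1 is no loss of generality: rescale the parameter. *)
definition C2_closed_parametrization :: "(real \<Rightarrow> real ^ 2) \<Rightarrow> (real ^ 2) set \<Rightarrow> bool" where
  "C2_closed_parametrization \<gamma> \<Gamma> \<longleftrightarrow>
     (\<forall>t. \<gamma> differentiable at t) \<and>
     (\<forall>t. (\<lambda>s. vector_derivative \<gamma> (at s)) differentiable at t) \<and>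
     continuous_on UNIV
       (\<lambda>t. vector_derivative (\<lambda>s. vector_derivative \<gamma> (at s)) (at t)) \<and>
     (\<forall>t. vector_derivative \<gamma> (at t) \<noteq> 0) \<and>
     (\<forall>t. \<gamma> (t + 1) = \<gamma> t) \<and> inj_on \<gamma> {0..<1} \<and> range \<gamma> = \<Gamma>"

definition C2_closed_curve :: "(real ^ 2) set \<Rightarrow> bool" where
  "C2_closed_curve \<Gamma> \<longleftrightarrow> (\<exists>\<gamma>. C2_closed_parametrization \<gamma> \<Gamma>)"

(* Image under \<gamma> of |\<gamma>'(t)| dt on [0,1). It does not depend on the regular
   parametrization by the change of variables formula, so the choice below is
   immaterial; it is only meaningful when C2_closed_curve \<Gamma> holds. *)
definition arc_length_measure :: "(real ^ 2) set \<Rightarrow> (real ^ 2) measure" where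
  "arc_length_measure \<Gamma> =
     (let \<gamma> = (SOME \<gamma>. C2_closed_parametrization \<gamma> \<Gamma>) in
       distr (density (restrict_space lborel {0..<1})
               (\<lambda>t. ennreal (norm (vector_derivative \<gamma> (at t)))))
             (restrict_space borel \<Gamma>) \<gamma>)"

definition heisenberg_uniqueness_pair :: "(real ^ 2) set \<Rightarrow> (real ^ 2) set \<Rightarrow> bool" where
  "heisenberg_uniqueness_pair \<Gamma> \<Lambda> \<longleftrightarrow>
     (\<forall>g :: real ^ 2 \<Rightarrow> complex.
        integrable (arc_length_measure \<Gamma>) g \<longrightarrow>
        (\<forall>\<xi>\<in>\<Lambda>. (LINT x|arc_length_measure \<Gamma>.
           exp (- \<i> * complex_of_real (\<xi> \<bullet> x)) * g x) = 0) \<longrightarrow>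
        (AE x in arc_length_measure \<Gamma>. g x = 0))"

definition line_through_origin :: "(real ^ 2) set \<Rightarrow> bool" where
  "line_through_origin \<Delta> \<longleftrightarrow> subspace \<Delta> \<and> dim \<Delta> = 1"

(* \<rho> is the non-obtuse angle; the unit vectors may be replaced by their negatives. *)
definition lines_make_angle :: "real \<Rightarrow> (real ^ 2) set \<Rightarrow> (real ^ 2) set \<Rightarrow> bool" where
  "lines_make_angle \<rho> \<Delta>1 \<Delta>2 \<longleftrightarrow>
     0 \<le> \<rho> \<and> \<rho> \<le> pi / 2 \<and>
     (\<exists>u\<in>\<Delta>1. \<exists>v\<in>\<Delta>2. norm u = 1 \<and> norm v = 1 \<and> u \<bullet> v = cos \<rho>)"

end

theory Submission
  imports Defs "HOL-Probability.Levy"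
begin

text \<open>
  Let \<open>\<gamma>\<close> be the parametrization, \<open>v\<^sub>\<theta> = (cos \<theta>, sin \<theta>)\<close> and \<open>f(t) = g(\<gamma>(t)) |\<gamma>'(t)|\<close>. If the Fourier transform
  of \<open>g d\<sigma>\<close> vanishes on the line spanned by \<open>v\<^sub>\<theta>\<close>, then by uniqueness of characteristic functions \<open>f\<close> has
  integral zero over every sublevel set of \<open>v\<^sub>\<theta> \<bullet> \<gamma>\<close>. By strict convexity each level set has at most two
  points in a period, and exchanging them gives a decreasing involution \<open>I\<^sub>\<theta>\<close> of the real line with
  \<open>I\<^sub>\<theta>(s + 1) = I\<^sub>\<theta>(s) - 1\<close>. The primitive \<open>F\<close> of \<open>f\<close> is then periodic and invariant under \<open>I\<^sub>\<theta>\<close>, so for two lines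
  it is invariant under the lift \<open>T\<^sub>\<theta> = I\<^sub>\<theta> \<circ> I\<^sub>0\<close> of a circle homeomorphism.

  A continuous periodic function invariant under \<open>T\<close> is constant if \<open>T\<close> induces a map without periodic points;
  otherwise it is locally constant off \<open>{x. T\<^sup>q x = x + p}\<close> for some \<open>q \<ge> 1\<close> and \<open>p\<close>. No rotation number is
  needed: a chord or tangent has only one direction, so \<open>I\<^sub>\<theta>\<close> and \<open>I\<^sub>\<theta>'\<close> never agree for \<open>\<theta> \<noteq> \<theta>'\<close> in
  \<open>[0, \<pi>/2)\<close>, hence the sets \<open>{x. T\<^sub>\<theta>\<^sup>q x = x + p}\<close> are pairwise disjoint in \<open>\<theta>\<close> and all but countably many
  angles make all of them null sets. For such an angle \<open>f = 0\<close> almost everywhere.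
\<close>

section \<open>Functions invariant under a degree one homeomorphism\<close>

lemma orbit_tendsto_fixed_point:
  fixes V :: "real \<Rightarrow> real"
  assumes cont: "continuous_on UNIV V" and mono: "mono V"
    and up: "y \<le> V y" and bd: "\<And>n. (V ^^ n) y \<le> c"
  obtains L where "(\<lambda>n. (V ^^ n) y) \<longlonglongrightarrow> L" "V L = L"
proof -
  have inc: "incseq (\<lambda>n. (V ^^ n) y)"
  proof (rule incseq_SucI)
    fix n show "(V ^^ n) y \<le> (V ^^ Suc n) y"
      using up by (induction n) (auto intro: monoD[OF mono])
  qed
  then obtain L where L: "(\<lambda>n. (V ^^ n) y) \<longlonglongrightarrow> L"
    using bd incseq_convergent by blast
  have "isCont V L" using cont by (simp add: continuous_on_eq_continuous_at)
  then have "(\<lambda>n. V ((V ^^ n) y)) \<longlonglongrightarrow> V L" using L isCont_tendsto_compose by blast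
  moreover have "(\<lambda>n. V ((V ^^ n) y)) \<longlonglongrightarrow> L" using LIMSEQ_Suc[OF L] by simp
  ultimately have "V L = L" using LIMSEQ_unique by blast
  with L show thesis using that by blast
qed

lemma invariant_funpow: "(\<And>x. F (V x) = F x) \<Longrightarrow> F ((V ^^ n) x) = F x"
  by (induction n) auto

text \<open>A bounded orbit of \<open>z\<close> would converge to a fixed point, which
  \<open>up\<close> excludes, so the images of \<open>{z..V z}\<close> cover the half line above
  \<open>z\<close>. Pulling \<open>w\<close> back along \<open>V\<close> into this first interval
  does not change \<open>F\<close>.\<close>

lemma invariant_oscillation_bound:
  fixes V F :: "real \<Rightarrow> real"
  assumes cont: "continuous_on UNIV V" and mono: "strict_mono V" and surj: "surj V"
    and up: "\<And>y. y < V y" and inv: "\<And>x. F (V x) = F x"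
    and osc: "\<And>w. z \<le> w \<Longrightarrow> w \<le> V z \<Longrightarrow> \<bar>F w - F z\<bar> \<le> e"
    and w: "z \<le> w"
  shows "\<bar>F w - F z\<bar> \<le> e"
proof -
  have "\<exists>k. w \<le> (V ^^ k) z"
  proof (rule ccontr)
    assume "\<not> ?thesis"
    then have "\<And>n. (V ^^ n) z \<le> w" by (meson linear)
    then obtain L where "V L = L"
      by (rule orbit_tendsto_fixed_point[OF cont strict_mono_mono[OF mono] less_imp_le[OF up]])
    then show False using up[of L] by simp
  qed
  then obtain k where "w \<le> (V ^^ k) z" by blast
  then show ?thesis using w
  proof (induction k arbitrary: w)
    case 0 then show ?case using osc[of z] less_imp_le[OF up] by auto
  next
    case (Suc k)
    show ?case
    proof (cases "w \<le> V z")
      case True then show ?thesis using osc Suc by blast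
    next
      case False
      obtain w' where w': "w = V w'" using surjD[OF surj] by blast
      have "w' \<le> (V ^^ k) z" using Suc.prems w' mono by (simp add: strict_mono_less_eq)
      moreover have "z \<le> w'" using False w' mono by (simp add: strict_mono_less_eq)
      ultimately show ?thesis using Suc.IH w' inv by simp
    qed
  qed
qed

text \<open>The iterates of \<open>w\<close> are squeezed between those of \<open>y\<close> and of
  \<open>V y\<close>, so the orbits of \<open>w\<close> and \<open>y\<close> converge to the same
  fixed point \<open>L\<close>. Continuity and invariance then give
  \<open>F w = F L = F y\<close>.\<close>

lemma invariant_constant_on_orbit_gap:
  fixes V F :: "real \<Rightarrow> real"
  assumes cont: "continuous_on UNIV V" and mono: "strict_mono V"
    and contF: "continuous_on UNIV F" and inv: "\<And>x. F (V x) = F x"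
    and up: "y \<le> V y" and c: "V c = c" "y \<le> c" and w: "y \<le> w" "w \<le> V y"
  shows "F w = F y"
proof -
  have pw: "strict_mono (V ^^ n)" for n
    using mono by (induction n) (auto simp: strict_mono_def)
  have bd: "(V ^^ n) y \<le> c" for n
  proof (induction n)
    case (Suc n) then have "V ((V ^^ n) y) \<le> V c" using mono by (simp only: strict_mono_less_eq)
    then show ?case using c by simp
  qed (simp add: c)
  obtain L where L: "(\<lambda>n. (V ^^ n) y) \<longlonglongrightarrow> L" "V L = L"
    using orbit_tendsto_fixed_point[OF cont strict_mono_mono[OF mono] up bd] .
  have lo: "(V ^^ n) y \<le> (V ^^ n) w" for n using pw w by (simp add: strict_mono_less_eq)
  have hi: "(V ^^ n) w \<le> (V ^^ Suc n) y" for n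
    using pw[of n] w(2) by (simp only: funpow_Suc_right o_apply strict_mono_less_eq)
  have Lw: "(\<lambda>n. (V ^^ n) w) \<longlonglongrightarrow> L"
    by (rule tendsto_sandwich[OF _ _ L(1) LIMSEQ_Suc[OF L(1)]]) (use lo hi in auto)
  have "isCont F L" using contF by (simp add: continuous_on_eq_continuous_at)
  then have *: "F x = F L" if "(\<lambda>n. (V ^^ n) x) \<longlonglongrightarrow> L" for x
  proof -
    have "(\<lambda>n. F ((V ^^ n) x)) \<longlonglongrightarrow> F L"
      using \<open>isCont F L\<close> that by (rule isCont_tendsto_compose)
    then show ?thesis by (simp only: invariant_funpow[of F V, OF inv] LIMSEQ_const_iff)
  qed
  show ?thesis using *[OF L(1)] *[OF Lw] by simp
qed

text \<open>The gaps from the preimage of \<open>y\<close> to \<open>y\<close> and from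
  \<open>y\<close> to \<open>V y\<close> both lie below the fixed point \<open>c\<close>. Together
  they form a neighbourhood of \<open>y\<close> on which \<open>F\<close> is constant.\<close>

lemma invariant_locally_constant:
  fixes V F :: "real \<Rightarrow> real"
  assumes cont: "continuous_on UNIV V" and mono: "strict_mono V" and surj: "surj V"
    and contF: "continuous_on UNIV F" and inv: "\<And>x. F (V x) = F x"
    and up: "y < V y" and c: "V c = c" "y \<le> c"
  shows "\<exists>a b. a < y \<and> y < b \<and> (\<forall>w\<in>{a..b}. F w = F y)"
proof -
  obtain x where x: "V x = y" using surjD[OF surj, of y] by metis
  have "x < y" using mono up x by (metis strict_mono_less)
  have "F w = F y" if "x \<le> w" "w \<le> V y" for w
  proof (cases "w \<le> y")
    case True
    then show ?thesis
      using invariant_constant_on_orbit_gap[where F=F, OF cont mono contF inv, of x c w] x inv[of x] \<open>x < y\<close> that c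
      by simp
  next
    case False
    then show ?thesis
      using invariant_constant_on_orbit_gap[where F=F, OF cont mono contF inv, of y c w] up that c by simp
  qed
  then have "\<forall>w\<in>{x..V y}. F w = F y" by simp
  then show ?thesis using \<open>x < y\<close> up by blast
qed

text \<open>A monotone surjection of the line has no jumps, so continuity comes for free. The
  inverse serves to turn maps that move points down into maps that move them up.\<close>

lemma strict_mono_surj_inverse:
  fixes V :: "real \<Rightarrow> real"
  assumes mono: "strict_mono V" and surj: "surj V"
  shows "strict_mono (inv V)" "surj (inv V)" "continuous_on UNIV (inv V)" "continuous_on UNIV V"
proof -
  have bij: "bij V" using assms by (simp add: bij_def strict_mono_on_imp_inj_on)
  show "strict_mono (inv V)" 
  proof (rule strict_monoI)
    fix x y :: real assume "x < y"
    then have "V (inv V x) < V (inv V y)" using surj by (simp add: surj_f_inv_f)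
    then show "inv V x < inv V y" using mono by (simp only: strict_mono_less)
  qed
  then have m: "mono (inv V)" by (rule strict_mono_mono)
  show s: "surj (inv V)" using bij bij_imp_bij_inv bij_def by blast
  have *: "continuous_on UNIV U" if "mono U" "surj U" for U :: "real \<Rightarrow> real"
    by (rule continuous_onI_mono) (use that in \<open>auto simp: mono_def\<close>)
  show "continuous_on UNIV (inv V)" "continuous_on UNIV V"
    using * m s surj mono by (auto intro: strict_mono_mono)
qed

section \<open>Lifts of degree one circle homeomorphisms\<close>

lemma degree_one_funpow:
  fixes T :: "real \<Rightarrow> real"
  assumes "\<And>x. T (x + 1) = T x + 1"
  shows "(T ^^ n) (x + 1) = (T ^^ n) x + 1"
  using assms by (induction n) auto

lemma periodic_int:
  fixes f :: "real \<Rightarrow> 'a"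
  assumes "\<And>x. f (x + 1) = f x"
  shows "f (x + of_int k) = f x"
proof -
  have n: "f (x + of_nat n) = f x" for x n
  proof (induction n)
    case (Suc n) then show ?case using assms[of "x + of_nat n"] by (simp add: add_ac)
  qed simp
  show ?thesis
  proof (cases k rule: int_cases2)
    case (nonpos m) then show ?thesis using n[of "x - of_nat m" m] by simp
  qed (use n in simp)
qed

lemma funpow_strict_mono_surj:
  fixes T :: "real \<Rightarrow> real"
  assumes "strict_mono T" "surj T"
  shows "strict_mono (T ^^ n)" "surj (T ^^ n)"
proof -
  show "strict_mono (T ^^ n)" using assms by (induction n) (auto simp: strict_mono_def)
  show "surj (T ^^ n)" using assms(2) by (rule surj_fn)
qed

text \<open>The cases are whether the circle map induced by \<open>T\<close> has a periodic point.
  If it does, an iterate followed by an integer shift has fixed points arbitrarily far out, and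
  \<open>F\<close> is locally constant near every point that this map moves. If not, the oscillation
  of \<open>F\<close> is smaller than any bound.\<close>

lemma invariant_dichotomy:
  fixes T F :: "real \<Rightarrow> real"
  assumes mono: "strict_mono T" and surj: "surj T" and deg: "\<And>x. T (x + 1) = T x + 1"
    and contF: "continuous_on UNIV F" and per: "\<And>x. F (x + 1) = F x"
    and inv: "\<And>x. F (T x) = F x"
  obtains "\<And>x y. F x = F y"
  | q p where "q > 0" "\<And>y. (T ^^ q) y \<noteq> y + of_int p \<Longrightarrow>
      \<exists>a b. a < y \<and> y < b \<and> (\<forall>w\<in>{a..b}. F w = F y)"
proof (cases "\<exists>q p y. q > 0 \<and> (T ^^ q) y = y + of_int p")
  case True
  then obtain q p y0 where q: "q > 0" "(T ^^ q) y0 = y0 + of_int p" by blast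
  define V where "V = (\<lambda>y. (T ^^ q) y - of_int p)"
  have V: "strict_mono V" "surj V"
  proof -
    show "strict_mono V" using funpow_strict_mono_surj(1)[OF mono surj, of q]
      by (auto simp: V_def strict_mono_def)
    show "surj V" unfolding surj_def V_def
      using funpow_strict_mono_surj(2)[OF mono surj, of q] by (metis add_diff_cancel surjD)
  qed
  note VI = strict_mono_surj_inverse[OF V]
  have inj: "inj V" using V by (simp add: strict_mono_on_imp_inj_on)
  have invV: "F (V x) = F x" for x
    using periodic_int[of F, OF per, of "(T ^^ q) x" "-p"] invariant_funpow[of F T, OF inv]
    by (simp add: V_def)
  have invI: "F (inv V x) = F x" for x using invV[of "inv V x"] V by (simp add: surj_f_inv_f)
  have Vdeg: "V (x + 1) = V x + 1" for x
    unfolding V_def using degree_one_funpow[of T, OF deg] by simp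
  \<comment> \<open>\<open>V x - x\<close> has period 1, so all integer translates of
    \<open>y0\<close> are fixed and every \<open>y\<close> has a fixed point above it.\<close>
  have fix0: "V (y0 + of_int k) = y0 + of_int k" for k
    using periodic_int[of "\<lambda>x. V x - x" y0 k] Vdeg q by (auto simp: V_def)
  have big: "\<exists>c. V c = c \<and> y \<le> c" for y
  proof (intro exI conjI)
    show "y \<le> y0 + of_int \<lceil>y - y0\<rceil>" by linarith
  qed (rule fix0)
  have "\<exists>a b. a < y \<and> y < b \<and> (\<forall>w\<in>{a..b}. F w = F y)" if "(T ^^ q) y \<noteq> y + of_int p" for y
  proof -
    obtain c where c: "V c = c" "y \<le> c" using big by blast
    have c': "inv V c = c" using c inj by (metis inv_f_f)
    have "V y \<noteq> y" using that by (auto simp: V_def)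
    \<comment> \<open>Where \<open>V\<close> moves \<open>y\<close> down, \<open>inv V\<close> moves
      it up, with the same fixed points and still leaving \<open>F\<close> invariant.\<close>
    moreover have "y < inv V y" if "V y < y"
      using that V(2) strict_mono_less[OF V(1), of y "inv V y"] by (simp add: surj_f_inv_f)
    ultimately consider "y < V y" | "y < inv V y" by linarith
    then show ?thesis
    proof cases
      case 1 show ?thesis
        by (rule invariant_locally_constant[where F=F, OF VI(4) V contF invV 1 c])
    next
      case 2 show ?thesis
        by (rule invariant_locally_constant[where F=F, OF VI(3,1,2) contF invI 2 c' c(2)])
    qed
  qed
  then show thesis using that(2) q by blast
next
  case False
  \<comment> \<open>By the pigeonhole principle some \<open>V = T\<^sup>q - p\<close> moves a point \<open>z\<close> by less than \<open>d\<close>. Having no fixed point,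
    \<open>V\<close> makes the translates of the interval between \<open>z\<close> and \<open>V z\<close> tile a half line, and \<open>F\<close> takes the same values on
    each of them.\<close>
  have bound: "\<bar>F x - F y\<bar> \<le> 2 * e" if e: "e > 0" for x y e
  proof -
    have "uniformly_continuous_on {0..2} F"
      by (rule compact_uniformly_continuous) (use contF continuous_on_subset in auto)
    then obtain d0 where d0: "d0 > 0"
        "\<And>x y. x \<in> {0..2} \<Longrightarrow> y \<in> {0..2} \<Longrightarrow> dist y x < d0 \<Longrightarrow> dist (F y) (F x) < e"
      unfolding uniformly_continuous_on_def using e by metis
    \<comment> \<open>The cap 1 keeps \<open>frac z + (w - z)\<close> within \<open>{0..2}\<close>,
      the interval on which uniform continuity is taken.\<close>
    define d where "d = min d0 1"
    have close: "\<bar>F w - F z\<bar> \<le> e" if "z \<le> w" "w < z + d" for w z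
    proof -
      have "dist (frac z + (w - z)) (frac z) < d0" using that by (auto simp: dist_real_def d_def)
      moreover have "frac z + (w - z) \<in> {0..2}" "frac z \<in> {0..2}"
        using that frac_lt_1[of z] frac_ge_0[of z] by (auto simp: d_def)
      ultimately have "dist (F (frac z + (w - z))) (F (frac z)) < e" using d0(2) by blast
      moreover have "frac z + (w - z) = w + of_int (- \<lfloor>z\<rfloor>)" "frac z = z + of_int (- \<lfloor>z\<rfloor>)"
        by (auto simp: frac_def)
      ultimately have "dist (F w) (F z) < e" by (simp only: periodic_int[of F, OF per])
      then show ?thesis by (simp add: dist_real_def)
    qed
    have "d > 0" using d0 by (simp add: d_def)
    obtain i j :: nat and p :: int where ij: "i < j" "\<bar>(T ^^ j) 0 - (T ^^ i) 0 - of_int p\<bar> < d"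
    proof -
      obtain N :: nat where N: "1 / d < N" "N > 0"
        using reals_Archimedean2[of "1 / d"] \<open>d > 0\<close>
        by (metis divide_pos_pos less_trans of_nat_0_less_iff zero_less_one)
      \<comment> \<open>\<open>B i\<close> numbers the subinterval of length \<open>1 / N\<close>
        that contains the fractional part of the \<open>i\<close>-th orbit point;
        \<open>N + 1\<close> indices compete for \<open>N\<close> subintervals.\<close>
      define B where "B = (\<lambda>i. nat \<lfloor>frac ((T ^^ i) 0) * N\<rfloor>)"
      have "B ` {..N} \<subseteq> {..<N}"
      proof safe
        fix i
        have "frac ((T ^^ i) 0) * N < N" using N frac_lt_1[of "(T ^^ i) 0"] by simp
        then have "\<lfloor>frac ((T ^^ i) 0) * N\<rfloor> < int N" by (simp add: floor_less_iff)
        then show "B i < N" using N by (simp add: B_def nat_less_iff)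
      qed
      then have "card (B ` {..N}) < card {..N}"
        using card_mono[of "{..<N}" "B ` {..N}"] by simp
      then have "\<not> inj_on B {..N}" using pigeonhole by blast
      then obtain i j where "B i = B j" "i < j"
        unfolding inj_on_def by (metis (lifting) linorder_neqE_nat)
      then have "\<lfloor>frac ((T ^^ i) 0) * N\<rfloor> = \<lfloor>frac ((T ^^ j) 0) * N\<rfloor>"
        by (simp add: B_def eq_nat_nat_iff)
      then have "\<bar>frac ((T ^^ j) 0) * N - frac ((T ^^ i) 0) * N\<bar> < 1" by linarith
      then have "\<bar>frac ((T ^^ j) 0) - frac ((T ^^ i) 0)\<bar> * N < 1"
        by (simp add: left_diff_distrib[symmetric] abs_mult)
      then have "\<bar>frac ((T ^^ j) 0) - frac ((T ^^ i) 0)\<bar> < 1 / N" using N by (simp add: field_simps)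
      also have "1 / N < d" using N \<open>d > 0\<close> by (simp add: field_simps)
      finally have "\<bar>(T ^^ j) 0 - (T ^^ i) 0 - of_int (\<lfloor>(T ^^ j) 0\<rfloor> - \<lfloor>(T ^^ i) 0\<rfloor>)\<bar> < d"
        by (simp add: frac_def algebra_simps)
      with \<open>i < j\<close> show thesis using that by blast
    qed
    define q where "q = j - i"
    define z0 where "z0 = (T ^^ i) 0"
    define V where "V = (\<lambda>y. (T ^^ q) y - of_int p)"
    have q: "q > 0" using ij by (simp add: q_def)
    have Vz: "\<bar>V z0 - z0\<bar> < d"
      using ij by (simp add: V_def z0_def q_def algebra_simps flip: funpow_add o_apply[of "T ^^ _" "T ^^ _"])
    have V: "strict_mono V" "surj V"
    proof -
      show "strict_mono V" using funpow_strict_mono_surj(1)[OF mono surj, of q]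
        by (auto simp: V_def strict_mono_def)
      show "surj V" 
      proof (rule surjI)
        fix y show "V (inv (T ^^ q) (y + of_int p)) = y"
          using funpow_strict_mono_surj(2)[OF mono surj, of q] by (simp add: V_def surj_f_inv_f)
      qed
    qed
    note VI = strict_mono_surj_inverse[OF V]
    have invV: "F (V x) = F x" for x
      using periodic_int[of F, OF per, of "(T ^^ q) x" "-p"] invariant_funpow[of F T, OF inv]
      by (simp add: V_def)
    have invI: "F (inv V x) = F x" for x using invV[of "inv V x"] V by (simp add: surj_f_inv_f)
    have nofix: "V y \<noteq> y" for y
    proof
      assume "V y = y" then have "(T ^^ q) y = y + of_int p" by (simp add: V_def)
      then show False using False q by blast
    qed
    \<comment> \<open>Having no zero, \<open>V y - y\<close> has constant sign. If it is negative,
      the estimate is applied to \<open>inv V\<close> from the starting point \<open>V z0\<close>,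
      which \<open>inv V\<close> sends to \<open>z0\<close>.\<close>
    have "\<exists>z. \<forall>w\<ge>z. \<bar>F w - F z\<bar> \<le> e"
    proof (cases "\<forall>y. y < V y")
      case True
      have "\<bar>F w - F z0\<bar> \<le> e" if "z0 \<le> w" for w
      proof (rule invariant_oscillation_bound[where F=F, OF VI(4) V _ invV _ that])
        show "\<bar>F w - F z0\<bar> \<le> e" if "z0 \<le> w" "w \<le> V z0" for w
          by (rule close) (use that Vz in linarith)+
      qed (use True in blast)
      then show ?thesis by blast
    next
      case False
      have all: "V y < y" for y
      proof (rule ccontr)
        assume "\<not> V y < y"
        then have 1: "0 \<le> V y - y" by simp
        from False obtain y' where "\<not> y' < V y'" by blast
        then have 2: "V y' - y' \<le> 0" by simp
        have "connected (range (\<lambda>y. V y - y))"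
          by (intro connected_continuous_image continuous_intros VI(4)) auto
        then have "0 \<in> range (\<lambda>y. V y - y)"
          by (rule connectedD_interval[OF _ _ _ 2 1]) auto
        then obtain x where "0 = V x - x" by blast
        then show False using nofix[of x] by simp
      qed
      have up: "y < inv V y" for y using all[of "inv V y"] V by (simp add: surj_f_inv_f)
      have eq: "inv V (V z0) = z0" using V by (simp add: strict_mono_on_imp_inj_on)
      have "\<bar>F w - F (V z0)\<bar> \<le> e" if "V z0 \<le> w" for w
      proof (rule invariant_oscillation_bound[where F=F, OF VI(3,1,2) up invI _ that])
        show "\<bar>F w - F (V z0)\<bar> \<le> e" if "V z0 \<le> w" "w \<le> inv V (V z0)" for w
          by (rule close) (use that Vz eq in linarith)+
      qed
      then show ?thesis by blast
    qed
    then obtain z where z: "\<And>w. z \<le> w \<Longrightarrow> \<bar>F w - F z\<bar> \<le> e" by blast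
    have "\<bar>F x - F z\<bar> \<le> e" for x
    proof -
      \<comment> \<open>Some integer translate of \<open>x\<close> lies above \<open>z\<close>, so
        periodicity carries the estimate from the half line to all points.\<close>
      have "z \<le> x + of_int \<lceil>z - x\<rceil>" by linarith
      from z[OF this] show ?thesis by (simp only: periodic_int[of F, OF per])
    qed
    from this[of x] this[of y] show ?thesis by linarith
  qed
  have "F x = F y" for x y
  proof (rule ccontr)
    assume "F x \<noteq> F y"
    \<comment> \<open>This choice of \<open>e\<close> bounds the positive difference by half of
      itself.\<close>
    then show False using bound[of "\<bar>F x - F y\<bar> / 4" x y] by auto
  qed
  then show thesis using that(1) by blast
qed

section \<open>The involution of a two-to-one function\<close>

lemma real_floor_decompose:
  fixes x a :: real
  shows "\<exists>n::int. a \<le> x - of_int n \<and> x - of_int n < a + 1"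
proof (intro exI conjI)
  show "a \<le> x - of_int \<lfloor>x - a\<rfloor>" "x - of_int \<lfloor>x - a\<rfloor> < a + 1" by linarith+
qed

text \<open>The graph of \<open>p\<close> over one period is repeated, raised by \<open>W\<close>
  each time; the condition \<open>W\<close> on the end values glues the copies without a
  jump.\<close>

lemma quasiperiodic_extension:
  fixes p :: "real \<Rightarrow> real"
  assumes mono: "strict_mono_on {a..a+1} p" and cont: "continuous_on {a..a+1} p"
    and W: "p (a + 1) = p a + W"
  obtains P where "strict_mono P" "surj P" "\<And>x. P (x + 1) = P x + W"
    "\<And>x. x \<in> {a..a+1} \<Longrightarrow> P x = p x"
proof
  define P where "P = (\<lambda>x. p (x - of_int \<lfloor>x - a\<rfloor>) + of_int \<lfloor>x - a\<rfloor> * W)"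
  have "p a < p (a + 1)" using mono by (simp add: strict_mono_on_def)
  then have Wpos: "W > 0" using W by simp
  show "strict_mono P"
  proof (rule strict_monoI)
    fix x y :: real assume xy: "x < y"
    define n m where "n = \<lfloor>x - a\<rfloor>" and "m = \<lfloor>y - a\<rfloor>"
    have n: "a \<le> x - of_int n" "x - of_int n < a + 1" unfolding n_def by linarith+
    have m: "a \<le> y - of_int m" "y - of_int m < a + 1" unfolding m_def by linarith+
    have "n \<le> m" using xy by (simp add: n_def m_def floor_mono)
    show "P x < P y"
    proof (cases "n = m")
      case True
      then have "p (x - of_int n) < p (y - of_int m)"
        using n m xy by (intro strict_mono_onD[OF mono]) auto
      then show ?thesis using True by (simp add: P_def n_def m_def)
    next
      case False
      then have "of_int (n + 1) * W \<le> of_int m * W"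
        using \<open>n \<le> m\<close> Wpos by (intro mult_right_mono) (auto simp flip: of_int_add)
      moreover have "p (x - of_int n) < p (a + 1)"
        using n by (intro strict_mono_onD[OF mono]) auto
      moreover have "p a \<le> p (y - of_int m)"
        using m by (intro mono_onD[OF strict_mono_on_imp_mono_on[OF mono]]) auto
      ultimately show ?thesis using W by (simp add: P_def algebra_simps flip: n_def m_def)
    qed
  qed
  show shift: "P (x + 1) = P x + W" for x
  proof -
    have "\<lfloor>x + 1 - a\<rfloor> = \<lfloor>x - a\<rfloor> + 1" by linarith
    then show ?thesis by (simp add: P_def algebra_simps)
  qed
  show eq: "P x = p x" if "x \<in> {a..a+1}" for x
  proof (cases "x = a + 1")
    case True then show ?thesis using W by (simp add: P_def)
  next
    case False
    then have "\<lfloor>x - a\<rfloor> = 0" using that by (intro floor_unique) auto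
    then show ?thesis by (simp add: P_def)
  qed
  show "surj P"
  proof -
    have "\<exists>x. P x = y" for y
    proof -
      define n where "n = \<lfloor>(y - p a) / W\<rfloor>"
      have "of_int n \<le> (y - p a) / W" "(y - p a) / W < of_int n + 1"
        unfolding n_def by linarith+
      then have n: "of_int n * W \<le> y - p a" "y - p a < (of_int n + 1) * W"
        using Wpos by (simp_all add: field_simps)
      then have "\<exists>x\<ge>a. x \<le> a + 1 \<and> p x = y - of_int n * W"
        by (intro IVT') (use cont W in \<open>auto simp: algebra_simps\<close>)
      then obtain x where x: "a \<le> x" "x \<le> a + 1" "p x = y - of_int n * W" by blast
      \<comment> \<open>\<open>P\<close> grows by \<open>W\<close> per period, so subtracting the
        linear function of slope \<open>W\<close> leaves a periodic one.\<close>
      have "P (x + of_int n) - W * (x + of_int n) = P x - W * x"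
        by (rule periodic_int[of "\<lambda>x. P x - W * x"]) (simp add: shift algebra_simps)
      then have "P (x + of_int n) = y" using x eq by (simp add: algebra_simps)
      then show ?thesis by blast
    qed
    then show ?thesis by (metis surj_def)
  qed
qed

text \<open>For a function as in the locale below, \<open>I\<close> exchanges on the circle the two
  points of each level; on the line it is a decreasing lift, whence \<open>I s - 1\<close>. The
  clause with \<open>n\<close> says that points fixed on the circle are extremal. In the last clause
  \<open>a\<close> is a minimum and \<open>b\<close> a maximum, and \<open>I\<close> carries the
  rising branch onto the falling branch just before it.\<close>

definition level_involution :: "(real \<Rightarrow> real) \<Rightarrow> (real \<Rightarrow> real) \<Rightarrow> bool" where
  "level_involution f I \<longleftrightarrow>
     strict_antimono_on UNIV I \<and> continuous_on UNIV I \<and>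
     (\<forall>s. I (I s) = s \<and> I (s + 1) = I s - 1 \<and> f (I s) = f s) \<and>
     (\<forall>s n. I s = s + of_int n \<longrightarrow> (\<forall>z. f s \<le> f z) \<or> (\<forall>z. f z \<le> f s)) \<and>
     (\<exists>a b. a < b \<and> b < a + 1 \<and> strict_mono_on {a..b} f \<and> strict_antimono_on {b-1..a} f \<and>
       I a = a \<and> I b = b - 1)"

lemma level_involutionD:
  assumes "level_involution f I"
  shows "x < y \<Longrightarrow> I y < I x" "continuous_on UNIV I" "I (I s) = s" "I (s + 1) = I s - 1" "f (I s) = f s"
    "I s = s + of_int n \<Longrightarrow> (\<forall>z. f s \<le> f z) \<or> (\<forall>z. f z \<le> f s)"
  using assms by (auto simp: level_involution_def monotone_on_def)

text \<open>Models the height of a strictly convex curve in a fixed direction: a line meets the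
  curve in at most two points, so no value is taken three times in a period.\<close>

locale two_to_one_circle_function =
  fixes f :: "real \<Rightarrow> real"
  assumes cont: "continuous_on UNIV f" and per: "\<And>x. f (x + 1) = f x"
    and two_to_one: "\<And>r s t. r < s \<Longrightarrow> s < t \<Longrightarrow> t < r + 1 \<Longrightarrow> f r = f s \<Longrightarrow> f s = f t \<Longrightarrow> False"
begin

lemma neg: "two_to_one_circle_function (\<lambda>x. - f x)"
proof
  show "continuous_on UNIV (\<lambda>x. - f x)" by (intro continuous_intros cont)
  show "- f (x + 1) = - f x" for x by (simp add: per)
  show False if "r < s" "s < t" "t < r + 1" "- f r = - f s" "- f s = - f t" for r s t
    using two_to_one[of r s t] that by simp
qed

lemma cont_on: "continuous_on S f"
  using cont continuous_on_subset by blast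

text \<open>Between two maxima, and again after the second one, \<open>f\<close> dips below its
  maximum. The level \<open>v\<close> lies above both dips, so by the intermediate value theorem it
  is taken three times within a period.\<close>

lemma max_unique:
  assumes max: "\<And>z. f z \<le> f x" and y: "f y = f x" "x < y" "y < x + 1"
  shows False
proof -
  define w where "w = (x + y) / 2"
  define w' where "w' = (y + x + 1) / 2"
  have w: "x < w" "w < y" "y < w'" "w' < x + 1" using y by (auto simp: w_def w'_def)
  have "f w \<noteq> f x" using two_to_one[of x w y] w y by auto
  moreover have "f w' \<noteq> f x" using two_to_one[of x y w'] w y by auto
  ultimately have lt: "f w < f x" "f w' < f x" using max[of w] max[of w'] by auto
  define v where "v = (max (f w) (f w') + f x) / 2"
  have v: "f w < v" "f w' < v" "v < f x" using lt by (auto simp: v_def)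
  obtain p1 where p1: "x \<le> p1" "p1 \<le> w" "f p1 = v"
    using IVT2'[of f w v x] v w cont_on by auto
  obtain p2 where p2: "w \<le> p2" "p2 \<le> y" "f p2 = v"
    using IVT'[of f w v y] v w y cont_on by auto
  obtain p3 where p3: "y \<le> p3" "p3 \<le> w'" "f p3 = v"
    using IVT2'[of f w' v y] v w y cont_on by auto
  have "p1 \<noteq> w" "p2 \<noteq> y" using p1 p2 v y by auto
  then show False using two_to_one[of p1 p2 p3] p1 p2 p3 w by auto
qed

lemma min_unique:
  assumes "\<And>z. f x \<le> f z" "f y = f x" "x < y" "y < x + 1"
  shows False
  using two_to_one_circle_function.max_unique[OF neg, of x y] assms by auto

text \<open>If \<open>f\<close> took a value twice on \<open>{a..b}\<close>, it would take it a
  third time on the way down from \<open>b\<close> to \<open>a + 1\<close>. The boundary cases,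
  where the three points are not distinct on the circle, contradict uniqueness of the maximum or of
  the minimum. So \<open>f\<close> is injective on \<open>{a..b}\<close>, hence monotone.\<close>

lemma strict_mono_between:
  assumes ab: "a < b" "b < a + 1" and min: "\<And>z. f a \<le> f z" and max: "\<And>z. f z \<le> f b"
  shows "strict_mono_on {a..b} f"
proof -
  have no: False if xy: "a \<le> x" "x < y" "y \<le> b" "f x = f y" for x y
  proof -
    have "\<exists>z\<ge>b. z \<le> a + 1 \<and> f z = f y"
    proof (rule IVT2')
      show "f (a + 1) \<le> f y" unfolding per by (rule min)
    qed (use max ab cont_on in auto)
    then obtain z where z: "b \<le> z" "z \<le> a + 1" "f z = f y" by blast
    show False
    proof (cases "y = b")
      case True
      then have x: "f b = f x" "x < b" "b < x + 1" using xy ab by auto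
      have "f z \<le> f x" for z using max[of z] unfolding x(1) .
      then show False using x by (rule max_unique)
    next
      case False
      show False
      proof (cases "z < x + 1")
        case True 
        show False by (rule two_to_one[of x y z]) (use xy z False True in linarith)+
      next
        case F: False
        then have "x = a" using z xy by linarith
        then have "f y = f a" "a < y" "y < a + 1" using xy ab by auto
        with min show False by (rule min_unique)
      qed
    qed
  qed
  have "inj_on f {a..b}"
  proof (rule inj_onI)
    fix x y assume "x \<in> {a..b}" "y \<in> {a..b}" "f x = f y"
    then show "x = y" using no[of x y] no[of y x] by (cases x y rule: linorder_cases) auto
  qed
  then consider "strict_mono_on {a..b} f" | "strict_antimono_on {a..b} f"
    using injective_eq_monotone_map[OF is_interval_cc cont_on, of a b] by auto
  then show ?thesis
  proof cases
    case 2
    then have "f b < f a" using ab by (auto simp: monotone_on_def)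
    then show ?thesis using min[of b] by simp
  qed
qed

lemma strict_antimono_between:
  assumes "a < b" "b < a + 1" "\<And>z. f z \<le> f a" "\<And>z. f b \<le> f z"
  shows "strict_antimono_on {a..b} f"
proof -
  have "strict_mono_on {a..b} (\<lambda>x. - f x)"
    by (rule two_to_one_circle_function.strict_mono_between[OF neg]) (use assms in simp_all)
  then show ?thesis by (simp add: monotone_on_def)
qed

lemma obtain_extrema:
  obtains a b where "a < b" "b < a + 1" "\<And>z. f a \<le> f z" "\<And>z. f z \<le> f b"
proof -
  have fr: "\<exists>z'\<in>{c..c+1}. f z = f z'" for z c
  proof -
    obtain n :: int where "c \<le> z - of_int n" "z - of_int n < c + 1"
      using real_floor_decompose by blast
    moreover have "f z = f (z - of_int n)" using periodic_int[of f, OF per, of z "-n"] by simp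
    ultimately show ?thesis by fastforce
  qed
  obtain a where a: "\<And>z. z \<in> {0..0+1} \<Longrightarrow> f a \<le> f z"
    using continuous_attains_inf[of "{0..0+1}" f] cont_on by fastforce
  have min: "f a \<le> f z" for z using fr[where c=0 and z=z] a by auto
  obtain b where b: "b \<in> {a..a+1}" "\<And>z. z \<in> {a..a+1} \<Longrightarrow> f z \<le> f b"
    using continuous_attains_sup[of "{a..a+1}" f] cont_on by fastforce
  have max: "f z \<le> f b" for z using fr[where c=a and z=z] b(2) by auto
  have "f b \<noteq> f a"
  proof
    assume "f b = f a"
    then have "f z = f a" for z using min[of z] max[of z] by auto
    note e = this[of 0] this[of "1/4"] this[of "1/2"]
    show False using two_to_one[of 0 "1/4" "1/2"] unfolding e by simp
  qed
  then have "b \<noteq> a" "b \<noteq> a + 1" using per[of a] by auto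
  then have "a < b" "b < a + 1" using b(1) by auto
  then show thesis using that min max by metis
qed

text \<open>A monotone unfolding \<open>P\<close> of \<open>f\<close> conjugates the wanted
  involution to the reflection of the line in 0, which is the image of the minimum
  \<open>a\<close>.\<close>

lemma level_involution_exists: "\<exists>I. level_involution f I"
proof -
  obtain a b where ab: "a < b" "b < a + 1" and min: "\<And>z. f a \<le> f z" and max: "\<And>z. f z \<le> f b"
    using obtain_extrema by metis
  have inc: "strict_mono_on {a..b} f" by (rule strict_mono_between[OF ab min max])
  have dec: "strict_antimono_on {b..a+1} f"
    by (rule strict_antimono_between) (use ab min max per in auto)
  have per': "f (b - 1) = f b" using per[of "b-1"] by simp
  have dec': "strict_antimono_on {b-1..a} f"
    by (rule strict_antimono_between) (use ab min max per' in auto)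
  \<comment> \<open>\<open>P\<close> unfolds \<open>f\<close>: it measures the total variation of \<open>f\<close> from \<open>a\<close>, so that reflecting \<open>P\<close> preserves \<open>f\<close>.\<close>
  define W where "W = 2 * (f b - f a)"
  have "f a < f b" using strict_mono_onD[OF inc, of a b] ab by auto
  then have Wpos: "W > 0" by (simp add: W_def)
  define p where "p = (\<lambda>s. if s \<le> b then f s - f a else 2 * f b - f a - f s)"
  have "strict_mono_on {a..a+1} p"
  proof (rule strict_mono_onI)
    fix r s assume rs: "r \<in> {a..a+1}" "s \<in> {a..a+1}" "r < s"
    consider "s \<le> b" | "b \<le> r" | "r < b" "b < s" by linarith
    then show "p r < p s"
    proof cases
      case 1 then show ?thesis using rs strict_mono_onD[OF inc, of r s] by (auto simp: p_def)
    next
      case 2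
      then have "f s < f r" using rs dec by (auto simp: monotone_on_def)
      then show ?thesis using 2 rs by (auto simp: p_def)
    next
      case 3
      then have "f r < f b" using rs strict_mono_onD[OF inc, of r b] by auto
      moreover have "f s < f b" using rs dec 3 by (auto simp: monotone_on_def)
      ultimately show ?thesis using 3 by (auto simp: p_def)
    qed
  qed
  moreover have "continuous_on ({a..b} \<union> {b..a+1}) p"
    unfolding p_def by (rule continuous_on_If) (auto intro!: continuous_intros cont_on)
  then have "continuous_on {a..a+1} p"
    by (rule continuous_on_subset) auto
  moreover have "p (a + 1) = p a + W" using ab per by (simp add: p_def W_def)
  ultimately obtain P where P: "strict_mono P" "surj P" "\<And>x. P (x + 1) = P x + W"
    "\<And>x. x \<in> {a..a+1} \<Longrightarrow> P x = p x"
    using quasiperiodic_extension by blast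
  have shift: "P (x + of_int n) = P x + of_int n * W" for x n
    using periodic_int[of "\<lambda>x. P x - W * x" x n] by (simp add: P(3) algebra_simps)
  have le: "P x \<le> P y \<longleftrightarrow> x \<le> y" for x y using P(1) by (rule strict_mono_less_eq)
  have inj: "P x = P y \<longleftrightarrow> x = y" for x y using P(1) by (rule strict_mono_eq)
  have Pa: "P a = 0" using P(4)[of a] ab by (simp add: p_def)
  have Pb: "P b = W / 2" using P(4)[of b] ab by (simp add: p_def W_def)
  define I where "I = (\<lambda>s. inv P (- P s))"
  have PI: "P (I s) = - P s" for s using P(2) by (simp add: I_def surj_f_inv_f)
  have fI: "f (I s) = f s" for s
  proof -
    obtain n :: int where n: "a \<le> s - of_int n" "s - of_int n < a + 1"
      using real_floor_decompose by blast
    define s' where "s' = s - of_int n"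
    \<comment> \<open>The translate of \<open>I s\<close> in the same period as \<open>s'\<close>:
      there \<open>P t = W - P s'\<close>, a reflection in \<open>W / 2 = P b\<close>, which swaps
      the rising and the falling branch.\<close>
    define t where "t = I s + of_int (n + 1)"
    have fs: "f s' = f s" using periodic_int[of f, OF per, of s "-n"] by (simp add: s'_def)
    have ft: "f t = f (I s)" unfolding t_def by (rule periodic_int[of f, OF per])
    have Ps: "P s' = P s - of_int n * W" using shift[of s "-n"] by (simp add: s'_def)
    have Pt: "P t = W - P s'" unfolding t_def shift PI Ps by (simp add: algebra_simps)
    have s': "s' \<in> {a..a+1}" using n by (simp add: s'_def)
    have 0: "0 \<le> P s'" "P s' \<le> W" using s' le[of a s'] le[of s' "a+1"] Pa P(3)[of a] by auto
    then have t: "t \<in> {a..a+1}" using le[of a t] le[of t "a+1"] Pa P(3)[of a] Pt by auto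
    have "f t = f s'"
    proof (cases "s' \<le> b")
      case True
      then have "P t \<ge> P b" using le[of s' b] Pb Pt by simp
      then have "b \<le> t" by (simp add: le)
      then have "P t = 2 * f b - f a - f t" using P(4)[OF t] by (auto simp: p_def)
      moreover have "P s' = f s' - f a" using P(4)[OF s'] True by (auto simp: p_def)
      ultimately show ?thesis using Pt by (simp add: W_def)
    next
      case False
      then have "P t \<le> P b" using le[of b s'] Pb Pt by simp
      then have "t \<le> b" by (simp add: le)
      then have "P t = f t - f a" using P(4)[OF t] by (auto simp: p_def)
      moreover have "P s' = 2 * f b - f a - f s'" using P(4)[OF s'] False by (auto simp: p_def)
      ultimately show ?thesis using Pt by (simp add: W_def)
    qed
    then show ?thesis using fs ft by simp
  qed
  \<comment> \<open>Such an \<open>s\<close> has \<open>P s = - n * W / 2\<close>, so it is an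
    integer translate of \<open>a\<close> when \<open>n\<close> is even and of \<open>b\<close> when
    \<open>n\<close> is odd.\<close>
  have ext: "(\<forall>z. f s \<le> f z) \<or> (\<forall>z. f z \<le> f s)" if "I s = s + of_int n" for s n
  proof -
    have Ps: "- P s = P s + of_int n * W" using PI[of s] that shift[of s n] by simp
    show ?thesis
    proof (cases "even n")
      case True
      then obtain m where m: "n = 2 * m" by (elim evenE)
      have "P (a + of_int (-m)) = - of_int m * W" using shift[of a "-m"] Pa by simp
      then have "P s = P (a + of_int (-m))" using Ps m by (simp add: algebra_simps)
      then have "s = a + of_int (-m)" by (simp only: inj)
      then have "f s = f a" using periodic_int[of f, OF per, of a "-m"] by simp
      then show ?thesis using min by simp
    next
      case False
      then obtain m where m: "n = 2 * m + 1" by (elim oddE)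
      have "P (b + of_int (-m - 1)) = W / 2 + of_int (-m - 1) * W" using shift[of b "-m-1"] Pb by simp
      then have "P s = P (b + of_int (-m - 1))" using Ps m by (simp add: algebra_simps)
      then have "s = b + of_int (-m - 1)" by (simp only: inj)
      then have "f s = f b" using periodic_int[of f, OF per, of b "-m-1"] by simp
      then show ?thesis using max by simp
    qed
  qed
  note PV = strict_mono_surj_inverse[OF P(1,2)]
  have anti: "strict_antimono_on UNIV I"
  proof (rule monotone_onI)
    fix x y :: real assume "x < y"
    then have "P (I y) < P (I x)" using P(1) by (simp add: PI strict_mono_less)
    then show "I x > I y" using P(1) by (simp add: strict_mono_less)
  qed
  have cont_I: "continuous_on UNIV I" unfolding I_def
    by (rule continuous_on_compose2[OF PV(3)]) (auto intro!: continuous_intros PV(4))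
  have invol: "I (I s) = s" for s using PI[of "I s"] PI[of s] by (simp add: inj)
  have deg: "I (s + 1) = I s - 1" for s
  proof -
    have "P (I (s + 1)) = P (I s - 1)"
      using PI[of "s+1"] PI[of s] P(3)[of s] P(3)[of "I s - 1"] by simp
    then show ?thesis by (simp only: inj)
  qed
  have "P (I a) = P a" using PI[of a] by (simp add: Pa)
  then have Ia: "I a = a" by (simp only: inj)
  have "P (I b) = P (b - 1)" using PI[of b] P(3)[of "b-1"] by (simp add: Pb)
  then have Ib: "I b = b - 1" by (simp only: inj)
  have "level_involution f I"
    unfolding level_involution_def
    by (intro conjI allI impI exI[of _ a] exI[of _ b])
       (fact ab anti cont_I invol deg fI ext inc dec' Ia Ib)+
  then show ?thesis by blast
qed

end

section \<open>Periodic primitives and vanishing Fourier transforms\<close>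

lemma set_integrable_periodic:
  fixes r :: "real \<Rightarrow> 'a :: {banach, second_countable_topology}"
  assumes per: "\<And>x. r (x + 1) = r x" and int: "set_integrable lborel {0..<1} r"
  shows "set_integrable lborel {x..y} r"
proof -
  have unit: "set_integrable lborel {of_int n..<of_int n + 1} r" for n :: int
  proof -
    have "integrable lborel (\<lambda>t. indicator {0..<1} (- of_int n + 1 * t) *\<^sub>R r (- of_int n + 1 * t))"
      using int unfolding set_integrable_def by (rule lborel_integrable_real_affine) simp
    moreover have "r (- of_int n + 1 * t) = r t" for t
      using periodic_int[of r, OF per, of t "-n"] by simp
    moreover have "indicator {0..<1} (- of_int n + 1 * t) = (indicator {of_int n..<of_int n + 1} t :: real)" for t :: real
      by (auto simp: indicator_def)
    ultimately show ?thesis by (simp add: set_integrable_def)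
  qed
  have long: "set_integrable lborel {of_int n..<of_int n + of_nat k} r" for n :: int and k
  proof (induction k)
    case 0 then show ?case by (simp add: set_integrable_def)
  next
    case (Suc k)
    have "{of_int n..<of_int n + of_nat (Suc k)} =
      {of_int n..<of_int n + of_nat k} \<union> {of_int (n + int k)..<of_int (n + int k) + (1::real)}"
      by auto
    then show ?case using Suc unit by (metis atLeastLessThan_borel set_integrable_Un sets_lborel)
  qed
  define k where "k = nat (\<lceil>y\<rceil> - \<lfloor>x\<rfloor>) + 1"
  have "{x..y} \<subseteq> {of_int \<lfloor>x\<rfloor>..<of_int \<lfloor>x\<rfloor> + of_nat k}"
  proof
    fix t assume t: "t \<in> {x..y}"
    then have "y < of_int \<lfloor>x\<rfloor> + of_nat k" unfolding k_def by auto linarith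
    then show "t \<in> {of_int \<lfloor>x\<rfloor>..<of_int \<lfloor>x\<rfloor> + of_nat k}" using t by auto linarith
  qed
  then show ?thesis by (rule set_integrable_subset[OF long, rotated]) simp
qed

lemma integrable_on_periodic:
  fixes r :: "real \<Rightarrow> real"
  assumes "\<And>x. r (x + 1) = r x" and "set_integrable lborel {0..<1} r"
  shows "r integrable_on {x..y}"
  using set_borel_integral_eq_integral(1)[OF set_integrable_periodic] assms by blast

lemma integral_periodic:
  fixes r :: "real \<Rightarrow> real"
  assumes per: "\<And>x. r (x + 1) = r x" and int: "set_integrable lborel {0..<1} r"
  shows "integral {x..x+1} r = (LINT t:{0..<1}|lborel. r t)"
proof -
  note io = integrable_on_periodic[of r, OF per int]
  have sh: "integral {u..v} r = integral {u + of_int n..v + of_int n} r" for u v n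
  proof -
    have "r \<circ> (+) (of_int n) = r"
      using periodic_int[of r, OF per] by (auto simp: add.commute)
    then show ?thesis using integral_shift_Icc_real[of u v r "of_int n"] by simp
  qed
  define s where "s = frac x"
  have s: "0 \<le> s" "s \<le> 1" by (auto simp: s_def frac_lt_1 less_imp_le)
  have "x = s + of_int \<lfloor>x\<rfloor>" by (simp add: s_def frac_def)
  then have "integral {x..x+1} r = integral {s..s+1} r" using sh[of s "s+1" "\<lfloor>x\<rfloor>"] by (simp add: add_ac)
  also have "\<dots> = integral {s..1} r + integral {1..s+1} r"
    using s io by (subst Henstock_Kurzweil_Integration.integral_combine) auto
  also have "integral {1..s+1} r = integral {0..s} r" using sh[of 0 s 1] by simp
  also have "integral {s..1} r + integral {0..s} r = integral {0..1} r"
    using s io by (subst add.commute, subst Henstock_Kurzweil_Integration.integral_combine) auto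
  also have "\<dots> = integral {0..<1} r"
    by (rule integral_spike_set) (auto intro: negligible_subset[of "{1}"])
  also have "\<dots> = (LINT t:{0..<1}|lborel. r t)"
    using set_borel_integral_eq_integral(2)[OF int] by simp
  finally show ?thesis .
qed

lemma periodic_antiderivative:
  fixes r :: "real \<Rightarrow> real"
  assumes per: "\<And>x. r (x + 1) = r x" and int: "set_integrable lborel {0..<1} r"
    and zero: "(LINT t:{0..<1}|lborel. r t) = 0"
  obtains F :: "real \<Rightarrow> real" where "continuous_on UNIV F" "\<And>x. F (x + 1) = F x"
    "\<And>x y. x \<le> y \<Longrightarrow> integral {x..y} r = F y - F x"
proof
  note io = integrable_on_periodic[of r, OF per int]
  \<comment> \<open>An integral over a reversed interval is 0, so one of the two terms always
    vanishes and the formula covers both signs of \<open>y\<close>.\<close>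
  define F where "F = (\<lambda>y. integral {0..y} r - integral {y..0} r)"
  have empty: "integral {u..v} r = 0" if "v \<le> u" for u v
    using that by (cases "v = u") auto
  show diff: "integral {x..y} r = F y - F x" if "x \<le> y" for x y
  proof -
    consider "0 \<le> x" | "y \<le> 0" | "x \<le> 0" "0 \<le> y" by linarith
    then show ?thesis
    proof cases
      case 1
      then show ?thesis using that Henstock_Kurzweil_Integration.integral_combine[OF 1 that io]
        by (simp add: F_def empty)
    next
      case 2
      then show ?thesis using that Henstock_Kurzweil_Integration.integral_combine[OF that 2 io]
        by (simp add: F_def empty)
    next
      case 3
      then show ?thesis using Henstock_Kurzweil_Integration.integral_combine[OF 3 io]
        by (simp add: F_def empty)
    qed
  qed
  show "F (x + 1) = F x" for x
    using diff[of x "x+1"] integral_periodic[of r x, OF per int] zero by simp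
  have "isCont F x" for x
  proof -
    have "continuous_on {x-1..x+1} (\<lambda>y. F (x-1) + integral {x-1..y} r)"
      by (intro continuous_intros indefinite_integral_continuous_1 io)
    then have "continuous_on {x-1..x+1} F"
      by (rule continuous_on_cong[THEN iffD1, rotated -1]) (auto simp: diff)
    then show ?thesis by (rule continuous_on_interior) simp
  qed
  then show "continuous_on UNIV F" by (simp add: continuous_at_imp_continuous_on)
qed

text \<open>The positive and negative parts of \<open>r\<close>, cut off to \<open>{a..b}\<close>,
  are densities of two finite measures that agree on all half lines. The measures are then equal,
  and so are the densities almost everywhere.\<close>

lemma AE_zero_if_interval_integrals_zero:
  fixes r :: "real \<Rightarrow> real"
  assumes int: "set_integrable lborel {a..b} r"
    and zero: "\<And>x. a \<le> x \<Longrightarrow> x \<le> b \<Longrightarrow> integral {x..b} r = 0"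
  shows "AE t in lborel. t \<in> {a..b} \<longrightarrow> r t = 0"
proof (cases "a \<le> b")
  case ab: True
  define h where "h = (\<lambda>t. indicator {a..b} t *\<^sub>R r t)"
  have hi: "integrable lborel h" using int by (simp add: h_def set_integrable_def)
  have [measurable]: "h \<in> borel_measurable borel" using borel_measurable_integrable[OF hi] by simp
  define p where "p = (\<lambda>t. max 0 (h t))"
  define n where "n = (\<lambda>t. max 0 (- h t))"
  have pi: "integrable lborel p" "integrable lborel n"
    unfolding p_def n_def using hi by auto
  have [measurable]: "p \<in> borel_measurable borel" "n \<in> borel_measurable borel"
    using pi by auto
  have pn: "p t \<ge> 0" "n t \<ge> 0" "p t - n t = h t" for t by (auto simp: p_def n_def)
  have em: "emeasure (density lborel q) {x<..} = ennreal (LINT t|lborel. q t * indicator {x<..} t)"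
    if "integrable lborel q" "\<And>t. q t \<ge> 0" for q :: "real \<Rightarrow> real" and x
  proof -
    have [measurable]: "q \<in> borel_measurable borel" using borel_measurable_integrable[OF that(1)] by simp
    have "emeasure (density lborel q) {x<..} = (\<integral>\<^sup>+t. ennreal (q t) * indicator {x<..} t \<partial>lborel)"
      by (rule emeasure_density) auto
    also have "\<dots> = (\<integral>\<^sup>+t. ennreal (q t * indicator {x<..} t) \<partial>lborel)"
      by (intro nn_integral_cong) (auto simp: indicator_def)
    also have "\<dots> = ennreal (LINT t|lborel. q t * indicator {x<..} t)"
      by (intro nn_integral_eq_integral integrable_real_mult_indicator) (use that in simp_all)
    finally show ?thesis .
  qed
  have eq: "(LINT t|lborel. p t * indicator {x<..} t) = (LINT t|lborel. n t * indicator {x<..} t)" for x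
  proof -
    \<comment> \<open>Up to the point \<open>x\<close>, the half line above \<open>x\<close> meets
      \<open>{a..b}\<close> in \<open>{y..b}\<close>.\<close>
    define y where "y = max a x"
    have "(LINT t|lborel. p t * indicator {x<..} t) - (LINT t|lborel. n t * indicator {x<..} t)
      = (LINT t|lborel. p t * indicator {x<..} t - n t * indicator {x<..} t)"
      by (subst Bochner_Integration.integral_diff) (auto intro!: integrable_real_mult_indicator pi)
    also have "\<dots> = (LINT t|lborel. h t * indicator {x<..} t)"
      by (intro Bochner_Integration.integral_cong) (auto simp flip: pn(3) simp: algebra_simps)
    also have "\<dots> = (LINT t|lborel. indicator {y..b} t *\<^sub>R r t)"
    proof (rule integral_cong_AE)
      show "(\<lambda>t. indicator {y..b} t *\<^sub>R r t) \<in> borel_measurable lborel"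
      proof -
        have "(\<lambda>t. indicator {y..b} t * h t) \<in> borel_measurable lborel" by measurable
        moreover have "indicator {y..b} t * h t = indicator {y..b} t *\<^sub>R r t" for t
          by (auto simp: h_def y_def indicator_def)
        ultimately show ?thesis by simp
      qed
      have "AE t in lborel. t \<noteq> x" by (rule AE_lborel_singleton)
      then show "AE t in lborel. h t * indicator {x<..} t = indicator {y..b} t *\<^sub>R r t"
        by eventually_elim (auto simp: h_def y_def indicator_def)
    qed simp
    also have "\<dots> = 0"
    proof (cases "y \<le> b")
      case True
      have "set_integrable lborel {y..b} r"
        by (rule set_integrable_subset[OF int]) (auto simp: y_def)
      from set_borel_integral_eq_integral(2)[OF this] zero[of y] True show ?thesis
        by (simp add: set_lebesgue_integral_def y_def)
    qed simp
    finally show ?thesis by simp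
  qed
  have "density lborel p = density lborel n"
  proof (rule measure_eqI_lessThan)
    show "emeasure (density lborel p) {x<..} < \<infinity>" for x by (simp add: em pi pn)
    show "emeasure (density lborel p) {x<..} = emeasure (density lborel n) {x<..}" for x
      by (simp add: em pi pn eq)
  qed auto
  then have "AE t in lborel. ennreal (p t) = ennreal (n t)"
    by (intro sigma_finite_measure.density_unique[OF lborel.sigma_finite_measure_axioms]) simp_all
  then show ?thesis
  proof eventually_elim
    case (elim t)
    then have "h t = 0" using pn[of t] by simp
    then show ?case by (auto simp: h_def)
  qed
qed auto

text \<open>The points in question are covered by intervals with rational endpoints on which
  \<open>F\<close> is constant. There are countably many of these, so their exceptional null sets
  can be united.\<close>

lemma AE_zero_locally_constant_antiderivative:
  fixes r F :: "real \<Rightarrow> real"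
  assumes int: "\<And>x y. set_integrable lborel {x..y} r"
    and F: "\<And>x y. x \<le> y \<Longrightarrow> integral {x..y} r = F y - F x"
  shows "AE t in lborel. (\<exists>a b. a < t \<and> t < b \<and> (\<forall>w\<in>{a..b}. F w = F t)) \<longrightarrow> r t = 0"
proof -
  define Q where "Q = {(x, y). x \<in> \<rat> \<and> y \<in> \<rat> \<and> (\<forall>w\<in>{x..y}. F w = F y)}"
  have "Q \<subseteq> \<rat> \<times> \<rat>" by (auto simp: Q_def)
  then have Q: "countable Q" by (rule countable_subset) (simp add: countable_rat)
  have "AE t in lborel. t \<in> {fst q..snd q} \<longrightarrow> r t = 0" if "q \<in> Q" for q
  proof (rule AE_zero_if_interval_integrals_zero[of "fst q" "snd q" r])
    show "set_integrable lborel {fst q..snd q} r" by (rule int)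
  next
    fix x assume x: "fst q \<le> x" "x \<le> snd q"
    have "\<forall>w\<in>{fst q..snd q}. F w = F (snd q)"
      using that unfolding Q_def case_prod_beta mem_Collect_eq by (elim conjE)
    moreover have "x \<in> {fst q..snd q}" using x by simp
    ultimately have "F x = F (snd q)" by (rule bspec)
    then show "integral {x..snd q} r = 0" using F[OF x(2)] by simp
  qed
  then have "\<forall>q\<in>Q. AE t in lborel. t \<in> {fst q..snd q} \<longrightarrow> r t = 0" by blast
  then have "AE t in lborel. \<forall>q\<in>Q. t \<in> {fst q..snd q} \<longrightarrow> r t = 0"
    by (simp only: AE_ball_countable[OF Q])
  then show ?thesis
  proof eventually_elim
    case (elim t)
    show ?case
    proof
      assume "\<exists>a b. a < t \<and> t < b \<and> (\<forall>w\<in>{a..b}. F w = F t)"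
      then obtain a b where ab: "a < t" "t < b" "\<And>w. w \<in> {a..b} \<Longrightarrow> F w = F t" by blast
      obtain x where x: "x \<in> \<rat>" "a < x" "x < t" using Rats_dense_in_real[OF ab(1)] by blast
      obtain y where y: "y \<in> \<rat>" "t < y" "y < b" using Rats_dense_in_real[OF ab(2)] by blast
      have "F w = F y" if "w \<in> {x..y}" for w
      proof -
        have "F w = F t" "F y = F t" by (rule ab(3); use that x y in simp)+
        then show ?thesis by simp
      qed
      then have "(x, y) \<in> Q" unfolding Q_def using x y by blast
      from bspec[OF elim this] show "r t = 0" using x y by simp
    qed
  qed
qed

section \<open>From vanishing Fourier integrals to invariance of the primitive\<close>

text \<open>The positive and negative parts of \<open>r\<close> have the same mass \<open>m\<close>,
  by the case \<open>s = 0\<close>. Normalised by \<open>m\<close> and pushed forward by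
  \<open>\<phi>\<close>, they become probability laws with the same characteristic function, so they
  give \<open>{..<c}\<close> the same mass. If \<open>m = 0\<close>, then \<open>r\<close> vanishes
  almost everywhere.\<close>

lemma characteristic_function_zero_imp_level_integrals_zero:
  fixes r \<phi> :: "'a \<Rightarrow> real"
  assumes r: "integrable M r" and \<phi> [measurable]: "\<phi> \<in> borel_measurable M"
    and zero: "\<And>s. (LINT t|M. iexp (s * \<phi> t) * complex_of_real (r t)) = 0"
  shows "(LINT t|M. indicator {..<c} (\<phi> t) * r t) = 0"
proof -
  have [measurable]: "r \<in> borel_measurable M" using r by simp
  define p where "p = (\<lambda>t. max 0 (r t))"
  define n where "n = (\<lambda>t. max 0 (- r t))"
  have pi: "integrable M p" "integrable M n" unfolding p_def n_def using r by auto
  have [measurable]: "p \<in> borel_measurable M" "n \<in> borel_measurable M" using pi by auto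
  have pn: "p t \<ge> 0" "n t \<ge> 0" "r t = p t - n t" for t by (auto simp: p_def n_def)
  have iexp_int: "integrable M (\<lambda>t. iexp (s * \<phi> t) * complex_of_real (q t))" if "integrable M q" for s q
  proof (rule Bochner_Integration.integrable_bound[OF that])
    show "(\<lambda>t. iexp (s * \<phi> t) * complex_of_real (q t)) \<in> borel_measurable M"
      using borel_measurable_integrable[OF that] by measurable
  qed (auto simp: norm_mult)
  note iexp_p = iexp_int[OF pi(1)] and iexp_n = iexp_int[OF pi(2)]
  have chareq: "(LINT t|M. iexp (s * \<phi> t) * complex_of_real (p t)) =
      (LINT t|M. iexp (s * \<phi> t) * complex_of_real (n t))" for s
    using zero[of s] Bochner_Integration.integral_diff[OF iexp_p[of s] iexp_n[of s]]
    unfolding pn(3) of_real_diff right_diff_distrib by simp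
  define m where "m = (LINT t|M. p t)"
  have m: "m = (LINT t|M. n t)" using chareq[of 0] by (simp add: m_def)
  have ind_int: "integrable M (\<lambda>t. indicator {..<c} (\<phi> t) * q t)" if "integrable M q" for q :: "'a \<Rightarrow> real"
  proof (rule Bochner_Integration.integrable_bound[OF that])
    show "(\<lambda>t. indicator {..<c} (\<phi> t) * q t) \<in> borel_measurable M"
      using borel_measurable_integrable[OF that] by measurable
  qed (auto simp: indicator_def)
  show ?thesis
  proof (cases "m = 0")
    case True
    have "AE t in M. p t = 0" "AE t in M. n t = 0"
      using integral_nonneg_eq_0_iff_AE[OF pi(1)] integral_nonneg_eq_0_iff_AE[OF pi(2)] pn True m
      by (auto simp: m_def)
    then have "AE t in M. indicator {..<c} (\<phi> t) * r t = 0"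
      by eventually_elim (simp add: pn(3))
    then show ?thesis by (rule integral_eq_zero_AE)
  next
    case False
    have "m \<ge> 0" unfolding m_def by (rule integral_nonneg_AE) (simp add: pn)
    then have mpos: "m > 0" using False by simp
    define N where "N = (\<lambda>q. distr (density M (\<lambda>t. ennreal (q t / m))) borel \<phi>)"
    have N_int: "(LINT x|N q. f x) = (LINT t|M. (q t / m) *\<^sub>R f (\<phi> t))"
      if [measurable]: "f \<in> borel_measurable borel" and "integrable M q" "\<And>t. q t \<ge> 0"
      for q and f :: "real \<Rightarrow> 'b :: {banach, second_countable_topology}"
    proof -
      have [measurable]: "q \<in> borel_measurable M" using that by simp
      have "(LINT x|N q. f x) = (LINT t|density M (\<lambda>t. ennreal (q t / m)). f (\<phi> t))"
        unfolding N_def by (rule integral_distr) auto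
      also have "\<dots> = (LINT t|M. (q t / m) *\<^sub>R f (\<phi> t))"
        by (rule integral_density) (use mpos that in auto)
      finally show ?thesis .
    qed
    have N_dist: "real_distribution (N q)"
      if "integrable M q" "\<And>t. q t \<ge> 0" "(LINT t|M. q t) = m" for q
    proof -
      have [measurable]: "q \<in> borel_measurable M" using that by simp
      have "emeasure (density M (\<lambda>t. ennreal (q t / m))) (space M) = (\<integral>\<^sup>+t. ennreal (q t / m) \<partial>M)"
        by (subst emeasure_density) (auto intro!: nn_integral_cong)
      also have "\<dots> = ennreal (LINT t|M. q t / m)"
        by (rule nn_integral_eq_integral) (use that mpos in auto)
      also have "\<dots> = 1" using that mpos by simp
      finally have "prob_space (density M (\<lambda>t. ennreal (q t / m)))"
        by (intro prob_spaceI) simp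
      then interpret prob_space "density M (\<lambda>t. ennreal (q t / m))" .
      show ?thesis unfolding N_def by (rule real_distribution_distr) simp
    qed
    have "N p = N n"
    proof (rule Levy_uniqueness)
      show "real_distribution (N p)" "real_distribution (N n)"
        by (rule N_dist; use pi pn m m_def in simp)+
      have "char (N q) s = (LINT t|M. iexp (s * \<phi> t) * complex_of_real (q t)) / m"
        if "integrable M q" "\<And>t. q t \<ge> 0" for q s
        unfolding char_def using that
        by (subst N_int) (auto simp: scaleR_conv_of_real mult.commute simp flip: integral_divide_zero)
      then show "char (N p) = char (N n)" using pi pn chareq by (auto simp: fun_eq_iff)
    qed
    then have "(LINT x|N p. indicat_real {..<c} x) = (LINT x|N n. indicat_real {..<c} x)" by simp
    moreover have "(LINT x|N q. indicat_real {..<c} x) = (LINT t|M. indicat_real {..<c} (\<phi> t) * q t) / m"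
      if "integrable M q" "\<And>t. q t \<ge> 0" for q
    proof -
      have "(LINT x|N q. indicat_real {..<c} x) = (LINT t|M. (q t / m) *\<^sub>R indicat_real {..<c} (\<phi> t))"
        by (rule N_int) (use that in simp_all)
      also have "\<dots> = (LINT t|M. indicat_real {..<c} (\<phi> t) * q t / m)" by (simp add: mult.commute)
      finally show ?thesis by simp
    qed
    ultimately have "(LINT t|M. indicat_real {..<c} (\<phi> t) * p t) / m = (LINT t|M. indicat_real {..<c} (\<phi> t) * n t) / m"
      using pi pn by metis
    then have "(LINT t|M. indicat_real {..<c} (\<phi> t) * p t) = (LINT t|M. indicat_real {..<c} (\<phi> t) * n t)"
      using mpos by simp
    then show ?thesis
      unfolding pn(3) right_diff_distrib
      by (subst Bochner_Integration.integral_diff) (auto intro: ind_int pi)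
  qed
qed

text \<open>The real part is half the sum of the function and its conjugate, and conjugation only
  reverses the sign of the frequency, so the hypothesis passes to the real part. The imaginary part
  of \<open>f\<close> is the real part of \<open>- \<i> * f\<close>.\<close>

lemma fourier_zero_imp_level_integrals_zero:
  fixes f :: "'a \<Rightarrow> complex" and \<phi> :: "'a \<Rightarrow> real"
  assumes f: "integrable M f" and \<phi> [measurable]: "\<phi> \<in> borel_measurable M"
    and zero: "\<And>s. (LINT t|M. exp (- \<i> * complex_of_real (s * \<phi> t)) * f t) = 0"
  shows "(LINT t|M. indicator {..<c} (\<phi> t) * Re (f t)) = 0"
    and "(LINT t|M. indicator {..<c} (\<phi> t) * Im (f t)) = 0"
proof -
  have main: "(LINT t|M. indicator {..<c} (\<phi> t) * Re (g t)) = 0"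
    if g: "integrable M g" and z: "\<And>s. (LINT t|M. exp (- \<i> * complex_of_real (s * \<phi> t)) * g t) = 0"
    for g :: "'a \<Rightarrow> complex"
  proof (rule characteristic_function_zero_imp_level_integrals_zero)
    show "integrable M (\<lambda>t. Re (g t))" using g by simp
    fix s
    have int: "integrable M (\<lambda>t. iexp (u * \<phi> t) * g' t)" if "integrable M g'" for u and g' :: "'a \<Rightarrow> complex"
    proof (rule Bochner_Integration.integrable_bound[OF that])
      show "(\<lambda>t. iexp (u * \<phi> t) * g' t) \<in> borel_measurable M"
        using borel_measurable_integrable[OF that] by measurable
    qed (auto simp: norm_mult)
    have 1: "(LINT t|M. iexp (s * \<phi> t) * g t) = 0" using z[of "-s"] by simp
    have "(LINT t|M. iexp (s * \<phi> t) * cnj (g t)) =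
        (LINT t|M. cnj (exp (- \<i> * complex_of_real (s * \<phi> t)) * g t))"
      by (intro Bochner_Integration.integral_cong) (auto simp: exp_cnj)
    also have "\<dots> = cnj (LINT t|M. exp (- \<i> * complex_of_real (s * \<phi> t)) * g t)"
      by (rule Bochner_Integration.integral_cnj)
    finally have 2: "(LINT t|M. iexp (s * \<phi> t) * cnj (g t)) = 0" by (simp only: z complex_cnj_zero)
    have "iexp (s * \<phi> t) * complex_of_real (Re (g t)) =
        (iexp (s * \<phi> t) * g t + iexp (s * \<phi> t) * cnj (g t)) / 2" for t
      by (simp add: complex_add_cnj flip: distrib_left)
    then have "(LINT t|M. iexp (s * \<phi> t) * complex_of_real (Re (g t))) =
      ((LINT t|M. iexp (s * \<phi> t) * g t) + (LINT t|M. iexp (s * \<phi> t) * cnj (g t))) / 2"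
      using int[OF g] int[of "\<lambda>t. cnj (g t)"] g
      by (simp only: integral_divide_zero) (subst Bochner_Integration.integral_add, auto)
    then show "(LINT t|M. iexp (s * \<phi> t) * complex_of_real (Re (g t))) = 0" using 1 2 by simp
  qed simp
  show "(LINT t|M. indicator {..<c} (\<phi> t) * Re (f t)) = 0" by (rule main[OF f zero])
  have "(LINT t|M. exp (- \<i> * complex_of_real (s * \<phi> t)) * (- \<i> * f t)) = 0" for s
  proof -
    have "(LINT t|M. exp (- \<i> * complex_of_real (s * \<phi> t)) * (- \<i> * f t)) =
      (LINT t|M. - \<i> * (exp (- \<i> * complex_of_real (s * \<phi> t)) * f t))"
      by (intro Bochner_Integration.integral_cong) auto
    also have "\<dots> = - \<i> * (LINT t|M. exp (- \<i> * complex_of_real (s * \<phi> t)) * f t)"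
      by (rule integral_mult_right_zero)
    finally show ?thesis by (simp only: zero mult_zero_right)
  qed
  from main[OF _ this] f show "(LINT t|M. indicator {..<c} (\<phi> t) * Im (f t)) = 0" by simp
qed

text \<open>On the period from \<open>b - 1\<close> to \<open>b\<close>, with the minimum
  \<open>a\<close> inside, the sublevel set of \<open>f s\<close> is the interval from
  \<open>I s\<close> to \<open>s\<close> up to endpoints. Its integral \<open>F s - F (I s)\<close>
  is therefore zero.\<close>

lemma antiderivative_level_involution:
  fixes r f F I :: "real \<Rightarrow> real"
  assumes per: "\<And>x. r (x + 1) = r x" and int: "set_integrable lborel {0..<1} r"
    and F: "\<And>x y. x \<le> y \<Longrightarrow> integral {x..y} r = F y - F x" and Fper: "\<And>x. F (x + 1) = F x"
    and fper: "\<And>x. f (x + 1) = f x" and fmeas: "f \<in> borel_measurable borel"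
    and zero: "\<And>c. (LINT t:{0..<1}|lborel. indicator {..<c} (f t) * r t) = 0"
    and I: "level_involution f I"
  shows "F (I s) = F s"
proof -
  obtain a b where ab: "a < b" "b < a + 1" and inc: "strict_mono_on {a..b} f"
    and dec: "strict_antimono_on {b-1..a} f" and Iab: "I a = a" "I b = b - 1"
    using I by (auto simp: level_involution_def)
  note D = level_involutionD[OF I]
  have Ile: "I y \<le> I x" if "x \<le> y" for x y using D(1)[of x y] that by (cases "x = y") auto
  have main: "F (I s) = F s" if s: "a \<le> s" "s \<le> b" for s
  proof -
    have Is: "b - 1 \<le> I s" "I s \<le> a" using Ile[OF s(1)] Ile[OF s(2)] Iab by auto
    define k where "k = (\<lambda>t. indicator {..<f s} (f t) * r t)"
    have k: "k t = (if t \<in> {I s..s} then r t else 0)" if t: "t \<in> {b-1..b} - {s, I s}" for t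
    proof -
      have "f t < f s \<longleftrightarrow> I s < t \<and> t < s"
      proof (cases "a \<le> t")
        case True
        have "f t < f s \<longleftrightarrow> t < s"
          using strict_mono_on_less[OF inc, of t s] True t s by auto
        then show ?thesis using True Is t by auto
      next
        case False
        have "f t < f (I s) \<longleftrightarrow> I s < t"
        proof
          assume "I s < t" then show "f t < f (I s)"
            using dec Is t False by (auto simp: monotone_on_def)
        next
          assume lt: "f t < f (I s)"
          show "I s < t"
          proof (rule ccontr)
            assume "\<not> I s < t"
            then have "t < I s" using t by auto
            then have "f (I s) < f t" using dec Is t False by (auto simp: monotone_on_def)
            then show False using lt by simp
          qed
        qed
        then show ?thesis using False s D(5)[of s] by auto
      qed
      then show ?thesis using t by (auto simp: k_def indicator_def)
    qed
    have "set_integrable lborel {0..<1} k"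
    proof -
      have "integrable lborel (\<lambda>t. (indicator {0..<1} t *\<^sub>R r t) * indicator (f -` {..<f s}) t)"
      proof (rule integrable_real_mult_indicator)
        have "f -` {..<f s} \<inter> space borel \<in> sets borel" by (rule measurable_sets[OF fmeas]) simp
        then show "f -` {..<f s} \<in> sets lborel" by simp
      qed (use int in \<open>simp add: set_integrable_def\<close>)
      moreover have "(indicator {0..<1} t *\<^sub>R r t) * indicator (f -` {..<f s}) t = indicator {0..<1} t *\<^sub>R k t" for t
        by (auto simp: k_def indicator_def)
      ultimately show ?thesis by (simp only: set_integrable_def)
    qed
    moreover have "k (t + 1) = k t" for t by (simp add: k_def per fper)
    ultimately have "integral {b-1..b-1+1} k = 0"
      using integral_periodic[of k "b-1"] zero[of "f s"] by (simp add: k_def)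
    also have "integral {b-1..b-1+1} k = integral {b-1..b} k" by simp
    also have "\<dots> = integral {b-1..b} (\<lambda>t. if t \<in> {I s..s} then r t else 0)"
      by (rule integral_spike[of "{s, I s}"]) (use k in auto)
    also have "\<dots> = integral ({I s..s} \<inter> {b-1..b}) r"
      by (rule Henstock_Kurzweil_Integration.integral_restrict_Int)
    also have "{I s..s} \<inter> {b-1..b} = {I s..s}" using Is s by auto
    finally show ?thesis using F[of "I s" s] Is s by simp
  qed
  obtain n :: int where n: "b - 1 \<le> s - of_int n" "s - of_int n < b - 1 + 1"
    using real_floor_decompose by blast
  define s' where "s' = s - of_int n"
  have s'F: "F s' = F s" using periodic_int[of F, OF Fper, of s "-n"] by (simp add: s'_def)
  \<comment> \<open>As \<open>I\<close> drops by 1 when its argument grows by 1,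
    \<open>I s + s\<close> is periodic.\<close>
  have "I (s + of_int (- n)) + (s + of_int (- n)) = I s + s"
    by (rule periodic_int[of "\<lambda>s. I s + s"]) (simp add: D)
  then have "I s' = I s + of_int n" by (simp add: s'_def)
  then have IF: "F (I s') = F (I s)" using periodic_int[of F, OF Fper] by simp
  have "F (I s') = F s'"
  proof (cases "a \<le> s'")
    case True then show ?thesis using main[of s'] n by (simp add: s'_def)
  next
    case False
    \<comment> \<open>On the falling branch the claim is applied to \<open>I s'\<close>, which lies
      on the rising branch, since \<open>I\<close> is an involution.\<close>
    then have "a \<le> I s'" "I s' \<le> b"
      using Ile[of s' a] Ile[of "b - 1" s'] Iab D(3)[of b] n by (auto simp: s'_def)
    from main[OF this] show ?thesis by (simp add: D(3))
  qed
  then show ?thesis using s'F IF by simp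
qed

section \<open>Chords of a strictly convex curve\<close>

text \<open>Otherwise the segment from \<open>x\<close> to \<open>z\<close> either lies in the
  frontier, against strictness, or contains an interior point \<open>p\<close>. In the latter case
  \<open>y\<close> lies strictly between \<open>p\<close> and a point of the closure, hence in the
  interior.\<close>

lemma strictly_convex_frontier_no_between:
  fixes \<Omega> :: "'a :: euclidean_space set"
  assumes conv: "convex \<Omega>"
    and strict: "\<And>a b. closed_segment a b \<subseteq> frontier \<Omega> \<Longrightarrow> a = b"
    and fr: "x \<in> frontier \<Omega>" "y \<in> frontier \<Omega>" "z \<in> frontier \<Omega>"
    and y: "y \<in> closed_segment x z" "y \<noteq> x" "y \<noteq> z"
  shows False
proof -
  have cl: "x \<in> closure \<Omega>" "z \<in> closure \<Omega>" using fr by (auto simp: frontier_def)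
  have "closed_segment x z \<subseteq> frontier \<Omega>"
  proof
    fix p assume p: "p \<in> closed_segment x z"
    show "p \<in> frontier \<Omega>"
    proof (rule ccontr)
      assume np: "p \<notin> frontier \<Omega>"
      have "closed_segment x z \<subseteq> closure \<Omega>"
        using cl convex_closure[OF conv] by (rule closed_segment_subset)
      then have pint: "p \<in> interior \<Omega>" using p np by (auto simp: frontier_def)
      have "y \<in> closed_segment p x \<or> y \<in> closed_segment p z"
        using Un_closed_segment[OF p] y(1) by (auto simp: closed_segment_commute)
      moreover have "y \<noteq> p" using fr(2) np by blast
      ultimately have "y \<in> open_segment p x \<or> y \<in> open_segment p z"
        using y by (auto simp: open_segment_def)
      then have "y \<in> interior \<Omega>"
        using in_interior_closure_convex_segment[OF conv pint] cl by blast
      then show False using fr(2) by (simp add: frontier_def)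
    qed
  qed
  then have "x = z" by (rule strict)
  then show False using y by simp
qed

section \<open>Vectors and directions in the plane\<close>

lemma inner_real_2: "(u :: real ^ 2) \<bullet> v = u $ 1 * v $ 1 + u $ 2 * v $ 2"
  by (simp add: inner_vec_def sum_2)

lemma vec_eq_2: "(u :: real ^ 2) = v \<longleftrightarrow> u $ 1 = v $ 1 \<and> u $ 2 = v $ 2"
  by (simp add: vec_eq_iff forall_2)

lemma orthogonal_2_parallel:
  fixes u a b :: "real ^ 2"
  assumes "u \<noteq> 0" "u \<bullet> a = 0" "u \<bullet> b = 0" "a \<noteq> 0"
  shows "\<exists>c. b = c *\<^sub>R a"
proof -
  have 1: "u $ 1 * a $ 1 + u $ 2 * a $ 2 = 0" "u $ 1 * b $ 1 + u $ 2 * b $ 2 = 0"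
    using assms by (simp_all add: inner_real_2)
  have "u $ 1 * (a $ 1 * b $ 2 - a $ 2 * b $ 1) = 0" "u $ 2 * (a $ 1 * b $ 2 - a $ 2 * b $ 1) = 0"
    using 1 by algebra+
  moreover have "u $ 1 \<noteq> 0 \<or> u $ 2 \<noteq> 0" using assms(1) by (auto simp: vec_eq_2)
  ultimately have 2: "a $ 1 * b $ 2 = a $ 2 * b $ 1" by auto
  show ?thesis
  proof (cases "a $ 1 = 0")
    case False
    then show ?thesis using 2 by (intro exI[of _ "b $ 1 / a $ 1"]) (simp add: vec_eq_2 field_simps)
  next
    case True
    then have "a $ 2 \<noteq> 0" using assms(4) by (auto simp: vec_eq_2)
    then show ?thesis using 2 True by (intro exI[of _ "b $ 2 / a $ 2"]) (simp add: vec_eq_2 field_simps)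
  qed
qed

definition direction :: "real \<Rightarrow> real ^ 2" where
  "direction \<theta> = vector [cos \<theta>, sin \<theta>]"

lemma inner_direction: "direction \<theta> \<bullet> direction \<theta>' = cos (\<theta> - \<theta>')"
  by (simp add: direction_def inner_real_2 cos_diff)

lemma norm_direction [simp]: "norm (direction \<theta>) = 1"
  by (simp add: norm_eq_sqrt_inner inner_direction)

lemma direction_nonzero [simp]: "direction \<theta> \<noteq> 0"
  using norm_direction[of \<theta>] by force

text \<open>\<open>sin (\<theta>' - \<theta>)\<close> is the determinant of the two directions, so
  they span the plane.\<close>

lemma orthogonal_two_directions:
  assumes "sin (\<theta>' - \<theta>) \<noteq> 0" "direction \<theta> \<bullet> w = 0" "direction \<theta>' \<bullet> w = 0"
  shows "w = 0"
proof -
  have 1: "cos \<theta> * w $ 1 + sin \<theta> * w $ 2 = 0" "cos \<theta>' * w $ 1 + sin \<theta>' * w $ 2 = 0"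
    using assms by (simp_all add: inner_real_2 direction_def)
  have "(sin \<theta>' * cos \<theta> - cos \<theta>' * sin \<theta>) * w $ 1 = 0" "(sin \<theta>' * cos \<theta> - cos \<theta>' * sin \<theta>) * w $ 2 = 0"
    using 1 by algebra+
  then show ?thesis using assms(1) by (simp add: sin_diff vec_eq_2)
qed

lemma derivative_zero_at_extremum:
  fixes f :: "real \<Rightarrow> real"
  assumes "(f has_real_derivative l) (at s)" and "(\<forall>z. f s \<le> f z) \<or> (\<forall>z. f z \<le> f s)"
  shows "l = 0"
  using assms(2)
proof
  assume "\<forall>z. f s \<le> f z" then show ?thesis using DERIV_local_min[OF assms(1), of 1] by simp
next
  assume "\<forall>z. f z \<le> f s" then show ?thesis using DERIV_local_max[OF assms(1), of 1] by simp
qed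

section \<open>The parametrized curve and its chords\<close>

locale strictly_convex_parametrization =
  fixes \<gamma> :: "real \<Rightarrow> real ^ 2" and \<Gamma> :: "(real ^ 2) set"
  assumes strictly_convex: "strictly_convex_closed_curve \<Gamma>"
    and param: "C2_closed_parametrization \<gamma> \<Gamma>"
begin

lemma period: "\<gamma> (t + 1) = \<gamma> t" and range: "range \<gamma> = \<Gamma>" and inj: "inj_on \<gamma> {0..<1}"
  using param by (auto simp: C2_closed_parametrization_def)

lemma derivative: "(\<gamma> has_vector_derivative vector_derivative \<gamma> (at t)) (at t)"
  and regular: "vector_derivative \<gamma> (at t) \<noteq> 0"
  using param by (auto simp: C2_closed_parametrization_def vector_derivative_works)

lemma continuous: "continuous_on UNIV \<gamma>"
  using param by (auto simp: C2_closed_parametrization_def intro!: continuous_at_imp_continuous_on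
      differentiable_imp_continuous_within)

lemma continuous_derivative: "continuous_on UNIV (\<lambda>t. vector_derivative \<gamma> (at t))"
  using param by (auto simp: C2_closed_parametrization_def intro!: continuous_at_imp_continuous_on
      differentiable_imp_continuous_within)

lemma derivative_period: "vector_derivative \<gamma> (at (t + 1)) = vector_derivative \<gamma> (at t)"
proof (rule vector_derivative_at)
  have "((\<lambda>s. \<gamma> (s - 1)) has_vector_derivative (1 - 0) *\<^sub>R vector_derivative \<gamma> (at t)) (at (t + 1))"
    by (rule vector_diff_chain_at[unfolded o_def]) (auto intro!: derivative_eq_intros derivative)
  then show "(\<gamma> has_vector_derivative vector_derivative \<gamma> (at t)) (at (t + 1))"
    using period by (metis (no_types, lifting) ext diff_add_cancel diff_zero scaleR_one)
qed

lemma eq_imp_shift: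
  assumes "\<gamma> s = \<gamma> t"
  obtains n :: int where "t = s + of_int n"
proof -
  have fr: "\<gamma> (frac x) = \<gamma> x" for x
    using periodic_int[of \<gamma>, OF period, of x "- \<lfloor>x\<rfloor>"] by (simp add: frac_def)
  have "frac s = frac t"
    using inj by (rule inj_onD) (use assms fr frac_lt_1 in auto)
  then have "t = s + of_int (\<lfloor>t\<rfloor> - \<lfloor>s\<rfloor>)" by (simp add: frac_def)
  then show thesis by (rule that)
qed

lemma neq: "s < t \<Longrightarrow> t < s + 1 \<Longrightarrow> \<gamma> s \<noteq> \<gamma> t"
proof
  assume st: "s < t" "t < s + 1" "\<gamma> s = \<gamma> t"
  obtain n :: int where "t = s + of_int n" using st(3) by (rule eq_imp_shift)
  then have "0 < n" "n < 1" using st by auto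
  then show False by simp
qed

text \<open>The three points lie on a line orthogonal to \<open>u\<close> and are distinct within a
  period, so one of them lies strictly between the others; strict convexity forbids this on the
  frontier.\<close>

lemma no_three_collinear:
  assumes "u \<noteq> 0" "r < s" "s < t" "t < r + 1" "u \<bullet> \<gamma> r = u \<bullet> \<gamma> s" "u \<bullet> \<gamma> s = u \<bullet> \<gamma> t"
  shows False
proof -
  obtain \<Omega> where \<Omega>: "convex \<Omega>" "\<Gamma> = frontier \<Omega>"
    and seg: "\<And>a b. closed_segment a b \<subseteq> \<Gamma> \<Longrightarrow> a = b"
    using strictly_convex unfolding strictly_convex_closed_curve_def by blast
  have d: "\<gamma> r \<noteq> \<gamma> s" "\<gamma> s \<noteq> \<gamma> t" "\<gamma> r \<noteq> \<gamma> t"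
    using neq[of r s] neq[of s t] neq[of r t] assms by linarith+
  have fr: "\<gamma> x \<in> frontier \<Omega>" for x using range \<Omega> by auto
  have "\<exists>c. \<gamma> t - \<gamma> s = c *\<^sub>R (\<gamma> r - \<gamma> s)"
    by (rule orthogonal_2_parallel[OF assms(1)]) (use assms d in \<open>auto simp: inner_diff_right\<close>)
  then have "collinear {\<gamma> r, \<gamma> s, \<gamma> t}" by (simp add: collinear_3 collinear_lemma)
  then consider "\<gamma> r \<in> closed_segment (\<gamma> s) (\<gamma> t)" | "\<gamma> s \<in> closed_segment (\<gamma> t) (\<gamma> r)"
    | "\<gamma> t \<in> closed_segment (\<gamma> r) (\<gamma> s)"
    by (auto simp: collinear_between_cases between_mem_segment)
  then show False
    by cases (use strictly_convex_frontier_no_between[OF \<Omega>(1) seg[unfolded \<Omega>(2)] fr fr fr] d in metis)+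
qed

lemma two_to_one_projection:
  assumes "u \<noteq> 0"
  shows "two_to_one_circle_function (\<lambda>t. u \<bullet> \<gamma> t)"
proof
  show "continuous_on UNIV (\<lambda>t. u \<bullet> \<gamma> t)" by (intro continuous_intros continuous)
qed (use no_three_collinear[OF assms] period in auto)

text \<open>Leads from a parameter to that of the other end of the chord perpendicular to
  \<open>direction \<theta>\<close>. At the extrema of the projection the chord shrinks to a point
  of tangency.\<close>

definition chord :: "real \<Rightarrow> real \<Rightarrow> real" where
  "chord \<theta> = (SOME I. level_involution (\<lambda>t. direction \<theta> \<bullet> \<gamma> t) I)"

lemma chord: "level_involution (\<lambda>t. direction \<theta> \<bullet> \<gamma> t) (chord \<theta>)"
  unfolding chord_def
  using two_to_one_circle_function.level_involution_exists[OF two_to_one_projection[OF direction_nonzero[of \<theta>]]]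
  by (rule someI_ex)

text \<open>A common image would make the chord vector orthogonal to two independent directions,
  hence zero, so both chords degenerate at \<open>s\<close>. Then both projections are extremal
  there, and the velocity is orthogonal to both directions, against regularity.\<close>

lemma chord_neq:
  assumes "sin (\<theta>' - \<theta>) \<noteq> 0"
  shows "chord \<theta> s \<noteq> chord \<theta>' s"
proof
  assume eq: "chord \<theta> s = chord \<theta>' s"
  have "direction \<theta> \<bullet> \<gamma> (chord \<theta> s) = direction \<theta> \<bullet> \<gamma> s"
    "direction \<theta>' \<bullet> \<gamma> (chord \<theta>' s) = direction \<theta>' \<bullet> \<gamma> s"
    using level_involutionD(5)[OF chord] by auto
  then have "\<gamma> (chord \<theta> s) - \<gamma> s = 0"
    using eq by (intro orthogonal_two_directions[OF assms]) (auto simp: inner_diff_right)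
  then have "\<gamma> s = \<gamma> (chord \<theta> s)" by simp
  then obtain n :: int where n: "chord \<theta> s = s + of_int n" by (rule eq_imp_shift)
  have "direction \<alpha> \<bullet> vector_derivative \<gamma> (at s) = 0" if "chord \<alpha> s = s + of_int n" for \<alpha>
  proof (rule derivative_zero_at_extremum)
    show "((\<lambda>t. direction \<alpha> \<bullet> \<gamma> t) has_real_derivative direction \<alpha> \<bullet> vector_derivative \<gamma> (at s)) (at s)"
      using bounded_linear.has_vector_derivative[OF bounded_linear_inner_right derivative]
      by (simp add: has_real_derivative_iff_has_vector_derivative)
  qed (rule level_involutionD(6)[OF chord that])
  then have "vector_derivative \<gamma> (at s) = 0"
    using n eq by (intro orthogonal_two_directions[OF assms]) auto
  then show False using regular by simp
qed

end

section \<open>Generic pairs of directions\<close>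

lemma funpow_strict_less:
  fixes U V :: "real \<Rightarrow> real"
  assumes less: "\<And>x. U x < V x" and mono: "strict_mono V" and "q > 0"
  shows "(U ^^ q) x < (V ^^ q) x"
proof -
  \<comment> \<open>The induction starts at one iterate, as zero iterates give equality.\<close>
  have step: "(U ^^ Suc n) x < (V ^^ Suc n) x" for n
  proof (induction n)
    case 0 then show ?case using less by simp
  next
    case (Suc n)
    have "U ((U ^^ Suc n) x) < V ((U ^^ Suc n) x)" by (rule less)
    also have "V ((U ^^ Suc n) x) < V ((V ^^ Suc n) x)" using Suc mono by (simp only: strict_mono_less)
    finally show ?case by simp
  qed
  from assms(3) show ?thesis using step[of "q - 1"] by simp
qed

lemma continuous_neq_imp_less:
  fixes U V :: "real \<Rightarrow> real"
  assumes "continuous_on UNIV U" "continuous_on UNIV V" "\<And>x. U x \<noteq> V x"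
  shows "(\<forall>x. U x < V x) \<or> (\<forall>x. V x < U x)"
proof (rule ccontr)
  assume "\<not> ?thesis"
  then obtain x y where xy: "V x - U x \<le> 0" "0 \<le> V y - U y" by (metis diff_le_0_iff_le diff_ge_0_iff_ge not_less)
  have "connected (range (\<lambda>x. V x - U x))"
    by (intro connected_continuous_image continuous_intros assms) auto
  then have "0 \<in> range (\<lambda>x. V x - U x)"
    by (rule connectedD_interval[OF _ _ _ xy]) auto
  then obtain z where "0 = V z - U z" by blast
  then show False using assms(3)[of z] by simp
qed

lemma continuous_funpow:
  fixes T :: "real \<Rightarrow> real"
  assumes "continuous_on UNIV T"
  shows "continuous_on UNIV (T ^^ n)"
proof (induction n)
  case (Suc n)
  then show ?case using continuous_on_compose2[OF assms Suc] by (simp add: o_def)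
qed (simp add: id_def)

lemma closed_periodic_points:
  fixes T :: "real \<Rightarrow> real"
  assumes "continuous_on UNIV T"
  shows "closed {x \<in> {0..1}. (T ^^ q) x = x + c}"
proof -
  have "closed ({0..1} \<inter> {x. (T ^^ q) x = x + c})"
    by (intro closed_Int closed_Collect_eq continuous_intros continuous_funpow assms)
  moreover have "{x \<in> {0..1}. (T ^^ q) x = x + c} = {0..1} \<inter> {x. (T ^^ q) x = x + c}" by auto
  ultimately show ?thesis by simp
qed

lemma fmeasurable_periodic_points:
  fixes T :: "real \<Rightarrow> real"
  assumes "continuous_on UNIV T"
  shows "{x \<in> {0..1}. (T ^^ q) x = x + c} \<in> fmeasurable lborel"
proof (rule fmeasurableI2[of "{0..1}"])
  show "{x \<in> {0..1}. (T ^^ q) x = x + c} \<in> sets lborel"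
    using closed_periodic_points[OF assms] by (simp only: sets_lborel borel_closed)
qed (auto simp: fmeasurable_def)

text \<open>Two of the maps never agree, so by continuity one lies strictly below the other, and so
  do their \<open>q\<close>-th iterates. The sets are therefore disjoint measurable subsets of the
  unit interval, and at most countably many can have positive measure.\<close>

lemma countable_angles_with_periodic_points:
  fixes T :: "'i \<Rightarrow> real \<Rightarrow> real"
  assumes mono: "\<And>i. i \<in> S \<Longrightarrow> strict_mono (T i)" and cont: "\<And>i. i \<in> S \<Longrightarrow> continuous_on UNIV (T i)"
    and neq: "\<And>i j x. i \<in> S \<Longrightarrow> j \<in> S \<Longrightarrow> i \<noteq> j \<Longrightarrow> T i x \<noteq> T j x" and q: "q > 0"
  shows "countable {i \<in> S. measure lborel {x \<in> {0..1}. (T i ^^ q) x = x + c} \<noteq> 0}"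
proof -
  define E where "E = (\<lambda>i. {x \<in> {0..1}. (T i ^^ q) x = x + c})"
  have disj: "E i \<inter> E j = {}" if ij: "i \<in> S" "j \<in> S" "i \<noteq> j" for i j
  proof -
    have "(T i ^^ q) x \<noteq> (T j ^^ q) x" for x
      using continuous_neq_imp_less[of "T i" "T j"] cont neq[OF ij] ij
        funpow_strict_less[of "T i" "T j" q x] funpow_strict_less[of "T j" "T i" q x] mono q
      by (metis less_irrefl)
    moreover have "(T i ^^ q) x = (T j ^^ q) x" if "x \<in> E i \<inter> E j" for x
      using that by (simp add: E_def)
    ultimately show ?thesis by blast
  qed
  have fm: "E i \<in> fmeasurable lborel" if "i \<in> S" for i
    unfolding E_def by (rule fmeasurable_periodic_points) (rule cont[OF that])
  have bound: "(\<Sum>i\<in>A. measure lborel (E i)) \<le> 1" if A: "A \<subseteq> S" "finite A" for A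
  proof -
    have "(\<Sum>i\<in>A. measure lborel (E i)) = measure lborel (\<Union>i\<in>A. E i)"
    proof (rule measure_finite_Union[symmetric])
      show "disjoint_family_on E A" using disj A by (auto simp: disjoint_family_on_def)
      show "emeasure lborel (E i) \<noteq> \<infinity>" if "i \<in> A" for i
        using fmeasurableD2[OF fm, of i] that A by auto
      show "E ` A \<subseteq> sets lborel" using A fm fmeasurableD by blast
    qed (rule A)
    also have "\<dots> \<le> measure lborel {0..1::real}"
    proof (rule measure_mono_fmeasurable)
      show "(\<Union>i\<in>A. E i) \<subseteq> {0..1}" by (auto simp: E_def)
      show "(\<Union>i\<in>A. E i) \<in> sets lborel" using A fm by (intro sets.finite_UN fmeasurableD) auto
    qed (auto simp: fmeasurable_def)
    finally show ?thesis by simp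
  qed
  have "(\<lambda>i. measure lborel (E i)) summable_on S"
    by (rule nonneg_bdd_above_summable_on) (auto intro!: bdd_aboveI[of _ 1] bound)
  then show ?thesis using summable_countable_real[of "\<lambda>i. measure lborel (E i)" S] by (simp add: E_def)
qed

section \<open>Composing the chord maps of two directions\<close>

context strictly_convex_parametrization
begin

text \<open>Each chord map reverses orientation, so the composite is an increasing lift of degree
  one, as the dichotomy for invariant functions requires.\<close>

definition turn :: "real \<Rightarrow> real \<Rightarrow> real" where
  "turn \<theta> = (\<lambda>s. chord \<theta> (chord 0 s))"

lemma strict_mono_turn: "strict_mono (turn \<theta>)"
  by (auto simp: strict_mono_def turn_def intro!: level_involutionD(1)[OF chord])

lemma surj_turn: "surj (turn \<theta>)"
  by (rule surjI[of _ "\<lambda>s. chord 0 (chord \<theta> s)"]) (simp add: turn_def level_involutionD(3)[OF chord])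

lemma turn_shift: "turn \<theta> (s + 1) = turn \<theta> s + 1"
  using level_involutionD(4)[OF chord, of \<theta> "chord 0 s - 1"]
  by (simp add: turn_def level_involutionD(4)[OF chord])

lemma continuous_turn: "continuous_on UNIV (turn \<theta>)"
  by (rule strict_mono_surj_inverse(4)[OF strict_mono_turn surj_turn])

text \<open>Each pair of \<open>q\<close> and \<open>p\<close> excludes countably many angles and
  there are countably many pairs, while the interval of angles is uncountable.\<close>

lemma generic_angle:
  obtains \<theta> where "0 < \<theta>" "\<theta> < pi / 2"
    "\<And>q p. q > 0 \<Longrightarrow> measure lborel {x \<in> {0..1}. (turn \<theta> ^^ q) x = x + of_int p} = 0"
proof -
  let ?S = "{0<..<pi/2}"
  define Bad where "Bad = (\<lambda>q p. {\<theta> \<in> ?S. measure lborel {x \<in> {0..1}. (turn \<theta> ^^ q) x = x + of_int p} \<noteq> 0})"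
  have "countable (Bad q p)" if "q > 0" for q :: nat and p :: int
    unfolding Bad_def
  proof (rule countable_angles_with_periodic_points[OF strict_mono_turn continuous_turn _ that])
    fix \<theta> \<theta>' x assume \<theta>: "\<theta> \<in> ?S" "\<theta>' \<in> ?S" "\<theta> \<noteq> \<theta>'"
    have "sin (\<theta>' - \<theta>) \<noteq> 0"
    proof
      assume "sin (\<theta>' - \<theta>) = 0"
      then have "\<theta>' - \<theta> = 0" by (rule sin_eq_0_pi[rotated 2]) (use \<theta> in auto)
      then show False using \<theta> by simp
    qed
    then show "turn \<theta> x \<noteq> turn \<theta>' x" unfolding turn_def by (rule chord_neq)
  qed
  then have "countable (\<Union>q\<in>{0<..}. \<Union>p. Bad q p)" by (intro countable_UN) auto
  moreover have "uncountable ?S" by (simp add: uncountable_open_interval)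
  ultimately obtain \<theta> where "\<theta> \<in> ?S" "\<theta> \<notin> (\<Union>q\<in>{0<..}. \<Union>p. Bad q p)"
    by (meson countable_subset subsetI)
  then show thesis using that[of \<theta>] by (auto simp: Bad_def)
qed

text \<open>The primitive of \<open>r\<close> is invariant under both chord maps, hence under
  \<open>turn \<theta>\<close>. By the dichotomy it is constant, or locally constant off a set that
  is null in the unit interval; \<open>r\<close> vanishes almost everywhere where its primitive is
  locally constant.\<close>

lemma AE_zero_if_level_integrals_zero:
  fixes r :: "real \<Rightarrow> real"
  assumes per: "\<And>x. r (x + 1) = r x" and int: "set_integrable lborel {0..<1} r"
    and zero: "\<And>c \<alpha>. \<alpha> \<in> {0, \<theta>} \<Longrightarrow>
      (LINT t:{0..<1}|lborel. indicator {..<c} (direction \<alpha> \<bullet> \<gamma> t) * r t) = 0"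
    and null: "\<And>q p. q > 0 \<Longrightarrow> measure lborel {x \<in> {0..1}. (turn \<theta> ^^ q) x = x + of_int p} = 0"
  shows "AE t in lborel. t \<in> {0..<1} \<longrightarrow> r t = 0"
proof -
  have proj: "two_to_one_circle_function (\<lambda>t. direction \<alpha> \<bullet> \<gamma> t)" for \<alpha>
    by (rule two_to_one_projection) simp
  \<comment> \<open>\<open>b\<close> maximises the projection, so the sublevel set for its value
    plus 1 is everything, and \<open>r\<close> has integral zero over a period.\<close>
  obtain b where b: "\<And>t. direction 0 \<bullet> \<gamma> t \<le> direction 0 \<bullet> \<gamma> b"
    using two_to_one_circle_function.obtain_extrema[OF proj] by metis
  have eq: "indicator {..<direction 0 \<bullet> \<gamma> b + 1} (direction 0 \<bullet> \<gamma> t) * r t = r t" for t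
    using b[of t] by (simp add: indicator_def)
  have "(LINT t:{0..<1}|lborel. indicator {..<direction 0 \<bullet> \<gamma> b + 1} (direction 0 \<bullet> \<gamma> t) * r t) = 0"
    by (rule zero) simp
  then have "(LINT t:{0..<1}|lborel. r t) = 0" unfolding eq .
  then obtain F where F: "continuous_on UNIV F" "\<And>x. F (x + 1) = F x"
    "\<And>x y. x \<le> y \<Longrightarrow> integral {x..y} r = F y - F x"
    using periodic_antiderivative[of r, OF per int] by metis
  have inv: "F (chord \<alpha> s) = F s" if "\<alpha> \<in> {0, \<theta>}" for \<alpha> s
  proof (rule antiderivative_level_involution[OF per int F(3,2) _ _ zero[OF that] chord])
    show "(\<lambda>t. direction \<alpha> \<bullet> \<gamma> t) \<in> borel_measurable borel"
      by (intro borel_measurable_continuous_onI continuous_intros continuous)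
  qed (simp_all add: period)
  have invT: "F (turn \<theta> s) = F s" for s by (simp add: turn_def inv)
  have lc: "AE t in lborel. (\<exists>a b. a < t \<and> t < b \<and> (\<forall>w\<in>{a..b}. F w = F t)) \<longrightarrow> r t = 0"
    by (rule AE_zero_locally_constant_antiderivative[OF set_integrable_periodic[OF per int] F(3)])
  from strict_mono_turn surj_turn turn_shift F(1,2) invT show ?thesis
  proof (rule invariant_dichotomy)
    assume "\<And>x y. F x = F y"
    then have "\<exists>a b. a < t \<and> t < b \<and> (\<forall>w\<in>{a..b}. F w = F t)" for t :: real
      by (meson lt_ex gt_ex)
    with lc show ?thesis by (auto elim: eventually_mono)
  next
    fix q p assume q: "(q::nat) > 0" and loc: "\<And>y. (turn \<theta> ^^ q) y \<noteq> y + of_int p \<Longrightarrow>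
      \<exists>a b. a < y \<and> y < b \<and> (\<forall>w\<in>{a..b}. F w = F y)"
    let ?E = "{x \<in> {0..1}. (turn \<theta> ^^ q) x = x + of_int p}"
    have "?E \<in> fmeasurable lborel"
      by (rule fmeasurable_periodic_points[OF continuous_turn])
    then have "emeasure lborel ?E = 0" "?E \<in> sets lborel"
      using null[OF q, of p] by (simp_all only: emeasure_eq_measure2 ennreal_0 fmeasurableD)
    then have "?E \<in> null_sets lborel" by (rule null_setsI)
    then have "AE t in lborel. t \<notin> ?E" by (rule AE_not_in)
    with lc show ?thesis
      by eventually_elim (use loc in auto)
  qed
qed

text \<open>On each line the Fourier integral is that of the projected curve at all real frequencies
  \<open>s\<close>. Its vanishing kills the sublevel integrals of the real and imaginary parts, and
  then the parts themselves.\<close>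

lemma heisenberg_uniqueness_pair:
  assumes arc: "arc_length_measure \<Gamma> =
       distr (density (restrict_space lborel {0..<1}) (\<lambda>t. ennreal (norm (vector_derivative \<gamma> (at t)))))
             (restrict_space borel \<Gamma>) \<gamma>"
    and null: "\<And>q p. q > 0 \<Longrightarrow> measure lborel {x \<in> {0..1}. (turn \<theta> ^^ q) x = x + of_int p} = 0"
  shows "heisenberg_uniqueness_pair \<Gamma> (span {direction 0} \<union> span {direction \<theta>})"
  unfolding heisenberg_uniqueness_pair_def
proof (intro allI impI)
  fix g :: "real ^ 2 \<Rightarrow> complex"
  assume g: "integrable (arc_length_measure \<Gamma>) g"
    and zero: "\<forall>\<xi>\<in>span {direction 0} \<union> span {direction \<theta>}.
      (LINT x|arc_length_measure \<Gamma>. exp (- \<i> * complex_of_real (\<xi> \<bullet> x)) * g x) = 0"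
  define w where "w = (\<lambda>t. norm (vector_derivative \<gamma> (at t)))"
  define M where "M = restrict_space lborel {0..<1::real}"
  have arc': "arc_length_measure \<Gamma> = distr (density M w) (restrict_space borel \<Gamma>) \<gamma>"
    unfolding w_def M_def by (rule arc)
  have w_pos: "w t > 0" for t using regular by (simp add: w_def)
  have w_meas: "w \<in> borel_measurable M"
  proof -
    have "w \<in> borel_measurable borel"
      unfolding w_def
      by (intro borel_measurable_continuous_onI continuous_intros continuous_derivative)
    then show ?thesis unfolding M_def by (intro measurable_restrict_space1) simp
  qed
  have \<gamma>_borel: "\<gamma> \<in> borel_measurable M"
    unfolding M_def
    by (rule measurable_restrict_space1) (simp add: borel_measurable_continuous_onI continuous)
  have \<gamma>_meas: "\<gamma> \<in> measurable M (restrict_space borel \<Gamma>)"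
    using \<gamma>_borel range by (intro measurable_restrict_space2) auto
  then have \<gamma>_dens: "\<gamma> \<in> measurable (density M w) (restrict_space borel \<Gamma>)"
    by simp
  have g_meas: "g \<in> borel_measurable (restrict_space borel \<Gamma>)"
    using borel_measurable_integrable[OF g] by (simp add: arc')
  have g\<gamma>_meas: "(\<lambda>t. g (\<gamma> t)) \<in> borel_measurable M"
    by (rule measurable_compose[OF \<gamma>_meas g_meas])
  \<comment> \<open>The speed \<open>w\<close> turns arc length integrals into Lebesgue integrals
    over one parameter period. As \<open>w\<close> is positive, \<open>f t = 0\<close> gives back
    \<open>g (\<gamma> t) = 0\<close>.\<close>
  define f where "f = (\<lambda>t. w t *\<^sub>R g (\<gamma> t))"
  have f_int: "integrable M f"
  proof -
    have "integrable (density M w) (\<lambda>t. g (\<gamma> t))"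
      using g unfolding arc' integrable_distr_eq[OF \<gamma>_dens g_meas] .
    then show ?thesis
      unfolding f_def by (subst (asm) integrable_density) (use g\<gamma>_meas w_meas w_pos less_imp_le in auto)
  qed
  have f_per: "f (t + 1) = f t" for t
    by (simp add: f_def w_def derivative_period period)
  have f_set: "set_integrable lborel {0..<1} f"
    using f_int unfolding M_def set_integrable_def by (subst (asm) integrable_restrict_space) auto
  have fourier: "(LINT t|M. exp (- \<i> * complex_of_real (s * (direction \<alpha> \<bullet> \<gamma> t))) * f t) = 0"
    if "\<alpha> \<in> {0, \<theta>}" for \<alpha> s
  proof -
    let ?h = "\<lambda>x. exp (- \<i> * complex_of_real ((s *\<^sub>R direction \<alpha>) \<bullet> x)) * g x"
    have h_meas: "?h \<in> borel_measurable (restrict_space borel \<Gamma>)"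
      by (intro borel_measurable_times g_meas measurable_restrict_space1 borel_measurable_continuous_onI
          continuous_intros)
    have "s *\<^sub>R direction \<alpha> \<in> span {direction 0} \<union> span {direction \<theta>}"
      using that by (auto intro: span_scale span_base)
    from bspec[OF zero this] have "0 = (LINT x|arc_length_measure \<Gamma>. ?h x)" by (rule sym)
    also have "\<dots> = (LINT t|density M w. ?h (\<gamma> t))"
      unfolding arc' by (rule integral_distr[OF \<gamma>_dens h_meas])
    also have "\<dots> = (LINT t|M. w t *\<^sub>R ?h (\<gamma> t))"
      by (rule integral_density) (use measurable_compose[OF \<gamma>_meas h_meas] w_meas w_pos less_imp_le in auto)
    also have "\<dots> = (LINT t|M. exp (- \<i> * complex_of_real (s * (direction \<alpha> \<bullet> \<gamma> t))) * f t)"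
      by (intro Bochner_Integration.integral_cong) (auto simp: f_def)
    finally show ?thesis by simp
  qed
  have restrict: "(LINT t:{0..<1}|lborel. u t) = (LINT t|M. u t)" for u :: "real \<Rightarrow> real"
    unfolding M_def set_lebesgue_integral_def by (subst integral_restrict_space) auto
  have proj_meas: "(\<lambda>t. direction \<alpha> \<bullet> \<gamma> t) \<in> borel_measurable M" for \<alpha>
    using \<gamma>_borel by (intro borel_measurable_inner) auto
  have "AE t in lborel. t \<in> {0..<1} \<longrightarrow> Re (f t) = 0"
  proof (rule AE_zero_if_level_integrals_zero[OF _ _ _ null])
    show "set_integrable lborel {0..<1} (\<lambda>t. Re (f t))"
      using f_set unfolding set_integrable_def by (auto dest: integrable_Re)
    show "(LINT t:{0..<1}|lborel. indicator {..<c} (direction \<alpha> \<bullet> \<gamma> t) * Re (f t)) = 0"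
      if "\<alpha> \<in> {0, \<theta>}" for c \<alpha>
      unfolding restrict by (rule fourier_zero_imp_level_integrals_zero[OF f_int proj_meas fourier[OF that]])
  qed (simp_all add: f_per)
  moreover have "AE t in lborel. t \<in> {0..<1} \<longrightarrow> Im (f t) = 0"
  proof (rule AE_zero_if_level_integrals_zero[OF _ _ _ null])
    show "set_integrable lborel {0..<1} (\<lambda>t. Im (f t))"
      using f_set unfolding set_integrable_def by (auto dest: integrable_Im)
    show "(LINT t:{0..<1}|lborel. indicator {..<c} (direction \<alpha> \<bullet> \<gamma> t) * Im (f t)) = 0"
      if "\<alpha> \<in> {0, \<theta>}" for c \<alpha>
      unfolding restrict by (rule fourier_zero_imp_level_integrals_zero[OF f_int proj_meas fourier[OF that]])
  qed (simp_all add: f_per)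
  ultimately have "AE t in lborel. t \<in> {0..<1} \<longrightarrow> g (\<gamma> t) = 0"
  proof eventually_elim
    case (elim t)
    have "g (\<gamma> t) = 0" if "Re (f t) = 0" "Im (f t) = 0"
      using that w_pos[of t] complex_eq_iff[of "f t" 0] by (simp add: f_def)
    then show ?case using elim by blast
  qed
  then have "AE t in M. g (\<gamma> t) = 0"
    unfolding M_def by (subst AE_restrict_space_iff) auto
  then have "AE t in density M w. g (\<gamma> t) = 0"
    by (subst AE_density) (use w_meas in auto)
  moreover have "{x \<in> space (restrict_space borel \<Gamma>). g x = 0} \<in> sets (restrict_space borel \<Gamma>)"
    using g_meas by measurable
  ultimately show "AE x in arc_length_measure \<Gamma>. g x = 0"
    unfolding arc' by (subst AE_distr_iff[OF \<gamma>_dens])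
qed

end

theorem theorem1p3:
  fixes \<Gamma> :: "(real ^ 2) set"
  assumes "strictly_convex_closed_curve \<Gamma>"
    and "C2_closed_curve \<Gamma>"
  shows "\<exists>\<rho> \<Delta>1 \<Delta>2. line_through_origin \<Delta>1 \<and> line_through_origin \<Delta>2 \<and> \<Delta>1 \<noteq> \<Delta>2 \<and>
    lines_make_angle \<rho> \<Delta>1 \<Delta>2 \<and>
    heisenberg_uniqueness_pair \<Gamma> (\<Delta>1 \<union> \<Delta>2)"
proof -
  \<comment> \<open>The same choice as in \<open>arc_length_measure\<close>, so that no change of
    parameter is needed.\<close>
  define \<gamma> where "\<gamma> = (SOME \<gamma>. C2_closed_parametrization \<gamma> \<Gamma>)"
  have "C2_closed_parametrization \<gamma> \<Gamma>"
    unfolding \<gamma>_def using assms(2) unfolding C2_closed_curve_def by (rule someI_ex)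
  with assms(1) interpret strictly_convex_parametrization \<gamma> \<Gamma>
    by unfold_locales
  obtain \<theta> where \<theta>: "0 < \<theta>" "\<theta> < pi / 2"
    and null: "\<And>q p. q > 0 \<Longrightarrow> measure lborel {x \<in> {0..1}. (turn \<theta> ^^ q) x = x + of_int p} = 0"
    using generic_angle by blast
  have "arc_length_measure \<Gamma> =
       distr (density (restrict_space lborel {0..<1}) (\<lambda>t. ennreal (norm (vector_derivative \<gamma> (at t)))))
             (restrict_space borel \<Gamma>) \<gamma>"
    by (simp add: arc_length_measure_def \<gamma>_def Let_def)
  from heisenberg_uniqueness_pair[OF this null]
  have "heisenberg_uniqueness_pair \<Gamma> (span {direction 0} \<union> span {direction \<theta>})" .
  moreover have "line_through_origin (span {direction \<alpha>})" for \<alpha>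
    by (simp add: line_through_origin_def dim_span dim_singleton)
  moreover have "span {direction 0} \<noteq> span {direction \<theta>}"
  proof
    assume "span {direction 0} = span {direction \<theta>}"
    then have "direction \<theta> \<in> span {direction 0}" by (simp add: span_base)
    then obtain k where "direction \<theta> = k *\<^sub>R direction 0" by (auto simp: span_singleton)
    then have "sin \<theta> = 0" by (simp add: direction_def vec_eq_2)
    then show False using \<theta> sin_gt_zero[of \<theta>] by simp
  qed
  moreover have "lines_make_angle \<theta> (span {direction 0}) (span {direction \<theta>})"
    unfolding lines_make_angle_def
  proof (intro conjI bexI)
    show "direction 0 \<bullet> direction \<theta> = cos \<theta>" by (simp add: inner_direction)
  qed (use \<theta> in \<open>auto intro: span_base\<close>)
  ultimately show ?thesis by blast
qed

end
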